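(* Let $K\ge1$ and let $(\mu,\Omega,\Lambda)$ be admissible parameters of the CFUSN family on $\mathbb{R}^K$. The characteristic function of $CFUSN(\mu,\Omega,\Lambda)$ is given, for all $t\in\mathbb{R}^K$, by $$CF(t)=\exp\left\{\iota t'\mu-\tfrac12 t'\Omega t\right\}\prod_{i=1}^K\left(1+\iota\,\Im(\Lambda_i't)\right),$$ where $\iota$ is the imaginary unit, $\Lambda_i$ is the $i$-th column of $\Lambda$, and $\Im(x)=\int_0^x\sqrt{2/\pi}\,\exp(u^2/2)\,du$ for $x\in\mathbb{R}$.
   Context: Canonical fundamental skew normal family (CFUSN): admissible parameters are $\mu\in\mathbb{R}^K$, a $K\times K$ (symmetric positive definite) covariance matrix $\Omega$, and a real $K\times K$ matrix $\Lambda$ such that $\Gamma=\Omega-\Lambda\Lambda'$ is positive semi-definite (equivalently $\Delta=I_K-\Lambda'\Omega^{-1}\Lambda$ is positive semi-definite, i.e. a covariance matrix). $CFUSN(\mu,\Omega,\Lambda)$ is the distribution on $\mathbb{R}^K$ with pdf $2^K\phi_K(x-\mu\,|\,\Omega)\,\Phi_K\left(\Lambda'\Omega^{-1}(x-\mu)\,|\,\Delta\right)$, where $\phi_K(\cdot|\Omega)$ is the pdf of the $K$-dimensional normal distribution with mean zero and covariance $\Omega$, $\Phi_K(\cdot|\Delta)$ is the cdf of the $K$-dimensional normal distribution with mean zero and covariance $\Delta$, $I_K$ is the identity matrix and $'$ denotes transpose. The characteristic function of a random vector $X$ is $t\mapsto E[\exp(\iota t'X)]$. *)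

theory Defs
  imports "HOL-Probability.Probability"
begin

definition pos_semidef :: "real^'n^'n \<Rightarrow> bool" where
  "pos_semidef A \<longleftrightarrow> transpose A = A \<and> (\<forall>x. 0 \<le> x \<bullet> (A *v x))"

definition pos_def :: "real^'n^'n \<Rightarrow> bool" where
  "pos_def A \<longleftrightarrow> transpose A = A \<and> (\<forall>x. x \<noteq> 0 \<longrightarrow> 0 < x \<bullet> (A *v x))"

definition normal_pdf :: "real^'n^'n \<Rightarrow> real^'n \<Rightarrow> real" where
  "normal_pdf \<Omega> x =
     exp (- (x \<bullet> (matrix_inv \<Omega> *v x)) / 2) / sqrt ((2 * pi) ^ CARD('n) * det \<Omega>)"

definition std_normal_vec :: "(real^'n) measure" where
  "std_normal_vec = density lborel (\<lambda>z. ennreal (\<Prod>i\<in>UNIV. std_normal_density (z $ i)))"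

text \<open>The centred normal law with a possibly singular covariance matrix \<open>\<Sigma>\<close>, as the law of
  \<open>A Z\<close> with \<open>Z\<close> standard normal and \<open>A A' = \<Sigma>\<close>. Such an \<open>A\<close> exists for every positive
  semi-definite \<open>\<Sigma>\<close>, and the law does not depend on its choice.\<close>

definition normal_law :: "real^'n^'n \<Rightarrow> (real^'n) measure" where
  "normal_law \<Sigma> = distr std_normal_vec borel (\<lambda>z. (SOME A::real^'n^'n. A ** transpose A = \<Sigma>) *v z)"

definition normal_cdf :: "real^'n^'n \<Rightarrow> real^'n \<Rightarrow> real" where
  "normal_cdf \<Sigma> y = measure (normal_law \<Sigma>) {z. \<forall>i. z $ i \<le> y $ i}"

definition cfusn_admissible :: "real^'n \<Rightarrow> real^'n^'n \<Rightarrow> real^'n^'n \<Rightarrow> bool" where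
  "cfusn_admissible \<mu> \<Omega> \<Lambda> \<longleftrightarrow> pos_def \<Omega> \<and> pos_semidef (\<Omega> - \<Lambda> ** transpose \<Lambda>)"

definition cfusn_Delta :: "real^'n^'n \<Rightarrow> real^'n^'n \<Rightarrow> real^'n^'n" where
  "cfusn_Delta \<Omega> \<Lambda> = mat 1 - transpose \<Lambda> ** matrix_inv \<Omega> ** \<Lambda>"

definition cfusn_pdf :: "real^'n \<Rightarrow> real^'n^'n \<Rightarrow> real^'n^'n \<Rightarrow> real^'n \<Rightarrow> real" where
  "cfusn_pdf \<mu> \<Omega> \<Lambda> x =
     2 ^ CARD('n) * normal_pdf \<Omega> (x - \<mu>) *
     normal_cdf (cfusn_Delta \<Omega> \<Lambda>) ((transpose \<Lambda> ** matrix_inv \<Omega>) *v (x - \<mu>))"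

definition CFUSN :: "real^'n \<Rightarrow> real^'n^'n \<Rightarrow> real^'n^'n \<Rightarrow> (real^'n) measure" where
  "CFUSN \<mu> \<Omega> \<Lambda> = density lborel (\<lambda>x. ennreal (cfusn_pdf \<mu> \<Omega> \<Lambda> x))"

definition char_vec :: "(real^'n) measure \<Rightarrow> real^'n \<Rightarrow> complex" where
  "char_vec M t = (CLINT x|M. iexp (t \<bullet> x))"

text \<open>The interval integral is oriented, so negative \<open>x\<close> is covered.\<close>

definition Im_fun :: "real \<Rightarrow> real" where
  "Im_fun x = (LBINT u=0..x. sqrt (2 / pi) * exp (u\<^sup>2 / 2))"

end

theory Submission
  imports Defs "HOL-Real_Asymp.Real_Asymp"
begin

text \<open>Let \<open>Y \<sim> N(0, \<Omega>)\<close> and let \<open>Z\<close> be an independent standard normal vector. With \<open>D D' = \<Delta>\<close> and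
  \<open>W = \<Lambda>'\<Omega>\<^sup>-\<^sup>1Y - D Z\<close>, the density says that the characteristic function at \<open>t\<close> equals
  \<open>2\<^sup>K exp(\<iota>t'\<mu>) E[exp(\<iota>t'Y); W \<ge> 0]\<close>. Here \<open>W\<close> is standard normal and \<open>t'Y\<close> has variance \<open>t'\<Omega>t\<close> and covariance
  vector \<open>s = \<Lambda>'t\<close> with \<open>W\<close>. A Gaussian law depends only on its Gram matrix, because two families of vectors with
  equal Gram matrices are related by an orthogonal map (a product of reflections), which preserves the standard normal
  law. So \<open>t'Y\<close> may be replaced by \<open>s'W + c Z\<^sub>0\<close> with \<open>Z\<^sub>0\<close> an independent standard normal variable and
  \<open>c\<^sup>2 = t'(\<Omega> - \<Lambda>\<Lambda>')t\<close>, and the expectation factorizes into the one-dimensional integrals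
  \<open>2 \<integral>\<^sub>0\<^sup>\<infinity> exp(\<iota>s\<^sub>iw) \<phi>(w) dw = exp(-s\<^sub>i\<^sup>2/2) (1 + \<iota> \<Im>(s\<^sub>i))\<close>, which are found from a linear
  differential equation in \<open>s\<^sub>i\<close>.\<close>

section \<open>Lebesgue measure under linear maps\<close>

lemma bij_betw_axis_Basis: "bij_betw (\<lambda>i. axis i 1) UNIV (Basis :: (real^'n) set)"
  by (auto simp: bij_betw_def Basis_vec_def inj_on_def axis_eq_axis)

lemma prod_Basis_vec: "(\<Prod>b\<in>Basis. f (b :: real^'n)) = (\<Prod>i\<in>UNIV. f (axis i 1))"
  by (rule prod.reindex_bij_betw[OF bij_betw_axis_Basis, symmetric])

text \<open>By \<open>measure_linear_sufficient\<close> only boxes matter. Translating a box so that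
  its lower corner is 0 makes the lower \<open>n\<close>-th coordinate nonnegative, as
  \<open>measure_shear_interval\<close> demands.\<close>

lemma measure_shear:
  fixes S :: "(real^'n) set" and m n :: 'n
  assumes "m \<noteq> n" and S: "S \<in> lmeasurable"
  defines "h \<equiv> \<lambda>x::real^'n. \<chi> i. if i = m then x$m + x$n else x$i"
  shows "measure lebesgue (h ` S) = measure lebesgue S"
proof -
  have lin: "linear h"
    unfolding h_def by (rule linearI) (auto simp: vec_eq_iff algebra_simps)
  have "measure lebesgue (h ` cbox a b) = 1 * measure lebesgue (cbox a b)" for a b
  proof (cases "cbox a b = {}")
    case False
    have box: "cbox a b = (+) a ` cbox 0 (b - a)"
      by (simp flip: cbox_translation)
    with False have ne: "cbox 0 (b - a) \<noteq> {}" by auto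
    have "h ` cbox a b = (+) (h a) ` h ` cbox 0 (b - a)"
      unfolding box image_image by (simp add: linear_add[OF lin])
    then have "measure lebesgue (h ` cbox a b) = measure lebesgue (h ` cbox 0 (b - a))"
      by (simp only: measure_translation)
    also have "\<dots> = measure lebesgue (cbox 0 (b - a))"
      unfolding h_def using measure_shear_interval[OF \<open>m \<noteq> n\<close> ne] by simp
    also have "\<dots> = measure lebesgue (cbox a b)"
      unfolding box by (simp only: measure_translation)
    finally show ?thesis by simp
  qed simp
  from measure_linear_sufficient[OF lin S this] show ?thesis by simp
qed

text \<open>The matrix arises from the identity by adding row \<open>n\<close> to row
  \<open>m\<close>, a determinant-preserving row operation.\<close>

lemma det_shear:
  assumes "m \<noteq> n"
  shows "det (matrix (\<lambda>x::real^'n. \<chi> i. if i = m then x$m + x$n else x$i)) = 1"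
proof -
  have "matrix (\<lambda>x::real^'n. \<chi> i. if i = m then x$m + x$n else x$i) =
    (\<chi> k. if k = m then row m (mat 1) + 1 *s row n (mat 1) else row k (mat 1))"
    using assms by (auto simp: vec_eq_iff matrix_def row_def mat_def axis_def)
  then show ?thesis
    using det_row_operation[OF assms, of "mat 1" 1] by simp
qed

text \<open>\<open>lborel\<close> is determined by its values on boxes. The preimage of a box is
  open, and it is bounded because it is the image under the inverse shear \<open>?g\<close>;
  \<open>h\<close> carries it back onto the box, so \<open>measure_shear\<close> compares the
  two.\<close>

lemma emeasure_lborel_shear:
  fixes A :: "(real^'n) set" and m n :: 'n
  assumes "m \<noteq> n" "A \<in> sets borel"
  defines "h \<equiv> \<lambda>x::real^'n. \<chi> i. if i = m then x$m + x$n else x$i"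
  shows "emeasure lborel (h -` A) = emeasure lborel A"
proof -
  have lin: "linear h"
    unfolding h_def by (rule linearI) (auto simp: vec_eq_iff algebra_simps)
  have cont: "continuous_on UNIV h"
    using lin by (simp add: linear_continuous_on linear_linear)
  then have [measurable]: "h \<in> borel_measurable borel"
    by (rule borel_measurable_continuous_onI)
  let ?g = "\<lambda>x::real^'n. \<chi> i. if i = m then x$m - x$n else x$i"
  have gh: "?g (h x) = x" "h (?g x) = x" for x
    using assms(1) by (auto simp: h_def vec_eq_iff)
  have ling: "linear ?g"
    by (rule linearI) (auto simp: vec_eq_iff algebra_simps)
  have "lborel = distr lborel borel h"
  proof (rule lborel_eqI)
    fix l u :: "real^'n" assume le: "\<And>b. b \<in> Basis \<Longrightarrow> l \<bullet> b \<le> u \<bullet> b"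
    have vim: "h -` box l u = ?g ` box l u"
      using gh by (auto simp: image_iff intro!: bexI[where x="h _"])
    have "bounded (h -` box l u)"
      unfolding vim using ling by (intro bounded_linear_image) (auto simp: linear_linear)
    moreover have "open (h -` box l u)"
      using cont by (simp add: open_vimage open_box)
    ultimately have lm: "h -` box l u \<in> lmeasurable"
      by (simp add: lmeasurable_open)
    have im: "h ` (h -` box l u) = box l u"
      using surj_image_vimage_eq[OF surjI[of h ?g]] gh(2) by simp
    have "emeasure lborel (h -` box l u) = ennreal (measure lebesgue (h -` box l u))"
      using emeasure_eq_measure2[OF lm] \<open>open (h -` box l u)\<close> by simp
    also have "measure lebesgue (h -` box l u) = measure lebesgue (box l u)"
      using measure_shear[OF assms(1) lm, folded h_def] im by simp
    also have "\<dots> = (\<Prod>b\<in>Basis. (u - l) \<bullet> b)"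
      using le by (simp add: measure_lborel_box_eq inner_diff_left)
    finally show "emeasure (distr lborel borel h) (box l u) = ennreal (\<Prod>b\<in>Basis. (u - l) \<bullet> b)"
      by (simp add: emeasure_distr)
  qed simp
  then have "emeasure lborel A = emeasure (distr lborel borel h) A" by simp
  then show ?thesis using assms(2) by (simp add: emeasure_distr)
qed

text \<open>The preimage of a box is the box with permuted corners, and reindexing leaves the
  product of the side lengths unchanged.\<close>

lemma emeasure_lborel_swap:
  fixes A :: "(real^'n) set" and m n :: 'n
  assumes "A \<in> sets borel"
  defines "h \<equiv> \<lambda>x::real^'n. \<chi> i. x $ Transposition.transpose m n i"
  shows "emeasure lborel (h -` A) = emeasure lborel A"
proof -
  let ?t = "Transposition.transpose m n"
  have [measurable]: "h \<in> borel_measurable borel"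
    unfolding h_def by (intro borel_measurable_continuous_onI continuous_intros)
  have "lborel = distr lborel borel h"
  proof (rule lborel_eqI)
    fix l u :: "real^'n" assume le: "\<And>b. b \<in> Basis \<Longrightarrow> l \<bullet> b \<le> u \<bullet> b"
    have le': "l $ i \<le> u $ i" for i
      using le[of "axis i 1"] by (simp add: inner_axis)
    have vim: "h -` box l u = box (h l) (h u)"
      by (auto simp: mem_box_cart h_def) (metis transpose_involutory)+
    have "(\<Prod>b\<in>Basis. (h u - h l) \<bullet> b) = (\<Prod>i\<in>UNIV. (u - l) $ ?t i)"
      by (simp add: prod_Basis_vec inner_axis h_def)
    also have "\<dots> = (\<Prod>i\<in>UNIV. (u - l) $ i)"
      by (rule prod.reindex_bij_betw[where h = ?t]) simp
    also have "\<dots> = (\<Prod>b\<in>Basis. (u - l) \<bullet> b)"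
      by (simp add: prod_Basis_vec inner_axis)
    finally have "(\<Prod>b\<in>Basis. (h u - h l) \<bullet> b) = (\<Prod>b\<in>Basis. (u - l) \<bullet> b)" .
    moreover have "h l \<bullet> b \<le> h u \<bullet> b" if "b \<in> Basis" for b
      using that le' by (auto simp: Basis_vec_def inner_axis h_def)
    ultimately show "emeasure (distr lborel borel h) (box l u) = ennreal (\<Prod>b\<in>Basis. (u - l) \<bullet> b)"
      by (simp add: emeasure_distr vim)
  qed simp
  then have "emeasure lborel A = emeasure (distr lborel borel h) A" by simp
  then show ?thesis using assms(1) by (simp add: emeasure_distr)
qed

lemma emeasure_lborel_stretch:
  fixes A :: "(real^'n) set"
  assumes "A \<in> sets borel" and c: "\<And>i. c i \<noteq> 0"
  shows "emeasure lborel A =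
    ennreal \<bar>\<Prod>i\<in>UNIV. c i\<bar> * emeasure lborel ((\<lambda>x. \<chi> i. c i * x $ i) -` A)"
proof -
  define h where "h = (\<lambda>x::real^'n. \<chi> i. c i * x $ i)"
  have [measurable]: "h \<in> borel_measurable borel"
    unfolding h_def by (intro borel_measurable_continuous_onI continuous_intros)
  \<comment> \<open>\<open>d\<close> attaches the factors to basis vectors instead of indices, the
    form that \<open>lborel_affine_euclidean\<close> expects.\<close>
  define d where "d b = c (THE i. b = axis i (1::real))" for b
  have d: "d (axis i 1) = c i" for i
    by (simp add: d_def axis_eq_axis)
  have h: "h = (\<lambda>x. 0 + (\<Sum>j\<in>Basis. (d j * (x \<bullet> j)) *\<^sub>R j))"
  proof
    fix x
    have "(\<Sum>j\<in>Basis. (d j * (x \<bullet> j)) *\<^sub>R j) = (\<Sum>i\<in>UNIV. (d (axis i 1) * (x \<bullet> axis i 1)) *\<^sub>R axis i 1)"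
      by (rule sum.reindex_bij_betw[OF bij_betw_axis_Basis, symmetric])
    also have "\<dots> = h x"
      unfolding d by (simp add: inner_axis vec_eq_iff h_def) (simp add: axis_def if_distrib cong: if_cong)
    finally show "h x = 0 + (\<Sum>j\<in>Basis. (d j * (x \<bullet> j)) *\<^sub>R j)" by simp
  qed
  have "lborel = density (distr lborel borel h) (\<lambda>_. (\<Prod>j\<in>Basis. \<bar>d j\<bar>))"
    unfolding h by (rule lborel_affine_euclidean) (use c in \<open>auto simp: Basis_vec_def d\<close>)
  then have "emeasure lborel A = emeasure (density (distr lborel borel h) (\<lambda>_. (\<Prod>j\<in>Basis. \<bar>d j\<bar>))) A"
    by simp
  also have "\<dots> = ennreal \<bar>\<Prod>i\<in>UNIV. c i\<bar> * emeasure lborel (h -` A)"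
    using assms(1) by (simp add: emeasure_density nn_integral_cmult_indicator emeasure_distr prod_Basis_vec d abs_prod)
  finally show ?thesis by (simp add: h_def)
qed

text \<open>The statement \<open>measure_linear_image\<close> of HOL-Analysis needs a well-ordered index type, whereas
  \<open>'n\<close> is an arbitrary finite type here.\<close>

lemma emeasure_lborel_linear_vimage:
  fixes f :: "real^'n \<Rightarrow> real^'n"
  assumes "linear f" "inj f" "A \<in> sets borel"
  shows "emeasure lborel A = ennreal \<bar>det (matrix f)\<bar> * emeasure lborel (f -` A)"
proof -
  \<comment> \<open>Injectivity belongs to the predicate of the induction over elementary maps. It
    makes the case of a vanishing coordinate contradictory and gives nonzero factors in the diagonal
    case.\<close>
  let ?P = "\<lambda>f::real^'n \<Rightarrow> real^'n. inj f \<longrightarrow> (\<forall>A\<in>sets borel.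
    emeasure lborel A = ennreal \<bar>det (matrix f)\<bar> * emeasure lborel (f -` A))"
  have "?P f"
  proof (rule induct_linear_elementary[OF assms(1), where P = ?P]; intro impI ballI)
    fix f g :: "real^'n \<Rightarrow> real^'n" and A :: "(real^'n) set"
    assume lin: "linear f" "linear g" and P: "?P f" "?P g" and inj: "inj (f \<circ> g)" and A: "A \<in> sets borel"
    \<comment> \<open>In finite dimension the injective \<open>g\<close> is onto, so the injectivity
      of the composition passes to \<open>f\<close> as well.\<close>
    have "inj g" using inj by (rule inj_on_imageI2)
    then have "surj g" using lin(2) by (simp add: linear_injective_imp_surjective)
    with inj \<open>inj g\<close> have "inj f"
      by (metis comp_def inj_def surjD)
    have "f -` A \<in> sets borel"
      using lin(1) A by (metis borel_measurable_continuous_onI linear_continuous_on linear_linear measurable_sets_borel)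
    then have "emeasure lborel A = ennreal \<bar>det (matrix f)\<bar> * (ennreal \<bar>det (matrix g)\<bar> * emeasure lborel (g -` f -` A))"
      using P A \<open>inj f\<close> \<open>inj g\<close> by metis
    then show "emeasure lborel A = ennreal \<bar>det (matrix (f \<circ> g))\<bar> * emeasure lborel ((f \<circ> g) -` A)"
      by (simp add: matrix_compose lin det_mul abs_mult ennreal_mult vimage_comp mult.assoc)
  next
    fix f :: "real^'n \<Rightarrow> real^'n" and i A
    assume "linear f" "\<And>x. f x $ i = 0" "inj f"
    then have False
      by (metis (full_types) linear_injective_imp_surjective one_neq_zero surjE vec_component)
    then show "emeasure lborel A = ennreal \<bar>det (matrix f)\<bar> * emeasure lborel (f -` A)" ..
  next
    fix c :: "'n \<Rightarrow> real" and A :: "(real^'n) set"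
    assume inj: "inj (\<lambda>x::real^'n. \<chi> i. c i * x $ i)" and A: "A \<in> sets borel"
    have "c i \<noteq> 0" for i
    proof
      assume "c i = 0"
      then have "(\<chi> j. c j * axis i 1 $ j) = (\<chi> j. c j * (0::real^'n) $ j)"
        by (simp add: vec_eq_iff axis_def)
      from injD[OF inj this] show False by simp
    qed
    then show "emeasure lborel A = ennreal \<bar>det (matrix (\<lambda>x::real^'n. \<chi> i. c i * x $ i))\<bar> *
        emeasure lborel ((\<lambda>x. \<chi> i. c i * x $ i) -` A)"
      using emeasure_lborel_stretch[OF A, of c] by (simp add: matrix_def axis_def det_diagonal)
  next
    fix m n :: 'n and A :: "(real^'n) set"
    assume A: "A \<in> sets borel"
    let ?h = "\<lambda>x::real^'n. \<chi> i. x $ Transposition.transpose m n i"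
    have "orthogonal_transformation ?h"
      unfolding orthogonal_transformation_def
    proof (intro conjI allI)
      show "linear ?h" by (rule linearI) (auto simp: vec_eq_iff)
      show "?h v \<bullet> ?h w = v \<bullet> w" for v w :: "real^'n"
        unfolding inner_vec_def
        using sum.reindex_bij_betw[of "Transposition.transpose m n" UNIV UNIV "\<lambda>i. v $ i \<bullet> w $ i"] by simp
    qed
    then have "\<bar>det (matrix ?h)\<bar> = 1" by (rule orthogonal_transformation_det)
    then show "emeasure lborel A = ennreal \<bar>det (matrix ?h)\<bar> * emeasure lborel (?h -` A)"
      using emeasure_lborel_swap[OF A] by simp
  next
    fix m n :: 'n and A :: "(real^'n) set"
    assume "m \<noteq> n" and A: "A \<in> sets borel"
    then show "emeasure lborel A = ennreal \<bar>det (matrix (\<lambda>x::real^'n. \<chi> i. if i = m then x$m + x$n else x$i))\<bar> *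
        emeasure lborel ((\<lambda>x. \<chi> i. if i = m then x$m + x$n else x$i) -` A)"
      using emeasure_lborel_shear[OF _ A, of m n] det_shear[of m n] by simp
  qed
  then show ?thesis using assms by blast
qed

lemma lborel_eq_density_distr_matrix:
  fixes B :: "real^'n^'n"
  assumes "det B \<noteq> 0"
  shows "lborel = density (distr lborel borel ((*v) B)) (\<lambda>_. ennreal \<bar>det B\<bar>)"
proof (rule measure_eqI)
  fix A :: "(real^'n) set" assume "A \<in> sets lborel"
  then have A: "A \<in> sets borel" by simp
  have [measurable]: "(*v) B \<in> borel_measurable borel"
    by (intro borel_measurable_continuous_onI continuous_intros)
  have "inj ((*v) B)"
    using assms by (simp add: inj_matrix_vector_mult invertible_det_nz)
  with emeasure_lborel_linear_vimage[OF _ this A]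
  have "emeasure lborel A = ennreal \<bar>det B\<bar> * emeasure lborel ((*v) B -` A)"
    by (simp add: matrix_vector_mul_linear)
  with A show "emeasure lborel A = emeasure (density (distr lborel borel ((*v) B)) (\<lambda>_. ennreal \<bar>det B\<bar>)) A"
    by (simp add: emeasure_density nn_integral_cmult_indicator emeasure_distr)
qed simp

section \<open>Matrix factorization and Gram matrices\<close>

lemma pos_semidef_inner_sym:
  assumes "pos_semidef R"
  shows "x \<bullet> (R *v y) = y \<bullet> (R *v x)"
  using assms unfolding pos_semidef_def by (metis dot_lmul_matrix inner_commute vector_transpose_matrix)

text \<open>The usual argument for a semi-inner product: the form is nonnegative on
  \<open>s *\<^sub>R x - r *\<^sub>R y\<close> for all \<open>s\<close> and \<open>r\<close>. The
  degenerate case \<open>?a = 0\<close> needs its own choice of coefficients.\<close>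

lemma pos_semidef_Cauchy_Schwarz:
  fixes R :: "real^'n^'n"
  assumes R: "pos_semidef R"
  shows "(x \<bullet> (R *v y))\<^sup>2 \<le> (x \<bullet> (R *v x)) * (y \<bullet> (R *v y))"
proof -
  let ?a = "y \<bullet> (R *v y)" and ?b = "x \<bullet> (R *v y)" and ?c = "x \<bullet> (R *v x)"
  have nonneg: "0 \<le> z \<bullet> (R *v z)" for z
    using R by (simp add: pos_semidef_def)
  have quad: "0 \<le> s\<^sup>2 * ?c - 2 * s * r * ?b + r\<^sup>2 * ?a" for s r
    using nonneg[of "s *\<^sub>R x - r *\<^sub>R y"] pos_semidef_inner_sym[OF R, of y x]
    by (simp add: matrix_vector_mult_diff_distrib matrix_vector_mult_scaleR inner_diff_left inner_diff_right
      power2_eq_square algebra_simps)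
  show ?thesis
  proof (cases "?a = 0")
    case True
    have "?b = 0"
    proof (rule ccontr)
      assume "?b \<noteq> 0"
      then show False
        \<comment> \<open>Since \<open>?a = 0\<close>, this \<open>r\<close> gives the quadratic
          expression the value -1.\<close>
        using quad[of 1 "(?c + 1) / (2 * ?b)"] True by simp
    qed
    then show ?thesis using True by simp
  next
    case False
    then have "0 < ?a" using nonneg[of y] by linarith
    have "0 \<le> ?a * (?a * ?c - ?b\<^sup>2)"
      using quad[of ?a ?b] by (simp add: power2_eq_square algebra_simps)
    with \<open>0 < ?a\<close> show ?thesis
      by (simp add: zero_le_mult_iff algebra_simps)
  qed
qed

text \<open>Cholesky elimination: removing the rank-one part \<open>v v'\<close> with \<open>v = R e\<^sub>i / \<surd>R\<^sub>i\<^sub>i\<close> from a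
  positive semi-definite \<open>R\<close> annihilates \<open>e\<^sub>i\<close> and preserves semi-definiteness by Cauchy-Schwarz.\<close>

lemma pos_semidef_eliminate:
  fixes R :: "real^'n^'n"
  assumes R: "pos_semidef R"
  obtains v where "pos_semidef (R - (\<chi> j k. v $ j * v $ k))"
    "(R - (\<chi> j k. v $ j * v $ k)) *v axis i 1 = 0"
    "\<And>k. R *v axis k 1 = 0 \<Longrightarrow> (R - (\<chi> j k. v $ j * v $ k)) *v axis k 1 = 0"
proof -
  let ?e = "axis i (1::real)"
  let ?r = "?e \<bullet> (R *v ?e)"
  have rank1: "(\<chi> j k. v $ j * v $ k) *v x = (v \<bullet> x) *\<^sub>R v" for v x :: "real^'n"
    by (simp add: vec_eq_iff matrix_vector_mult_def inner_vec_def sum_distrib_left algebra_simps)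
  have sym: "transpose R = R" using R by (simp add: pos_semidef_def)
  have r: "0 \<le> ?r" using R by (simp add: pos_semidef_def)
  \<comment> \<open>If the diagonal entry \<open>?r\<close> is 0, then \<open>R *v ?e = 0\<close> by
    Cauchy-Schwarz, so there is nothing to remove and \<open>v = 0\<close> works.\<close>
  define v where "v = (if ?r = 0 then 0 else (1 / sqrt ?r) *\<^sub>R (R *v ?e))"
  have vx: "(v \<bullet> x)\<^sup>2 * ?r = (x \<bullet> (R *v ?e))\<^sup>2" for x
  proof (cases "?r = 0")
    case True
    then show ?thesis using pos_semidef_Cauchy_Schwarz[OF R, of x ?e] by (simp add: v_def)
  next
    case False
    then show ?thesis using r by (simp add: v_def power_divide inner_commute)
  qed
  let ?R = "R - (\<chi> j k. v $ j * v $ k)"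
  have Rx: "?R *v x = R *v x - (v \<bullet> x) *\<^sub>R v" for x
    by (simp add: matrix_vector_mult_diff_rdistrib rank1)
  have vle: "(v \<bullet> x)\<^sup>2 \<le> x \<bullet> (R *v x)" for x
  proof (cases "?r = 0")
    case True
    then show ?thesis using R by (simp add: v_def pos_semidef_def)
  next
    case False
    then have "0 < ?r" using r by linarith
    have "(v \<bullet> x)\<^sup>2 * ?r \<le> (x \<bullet> (R *v x)) * ?r"
      unfolding vx by (rule pos_semidef_Cauchy_Schwarz[OF R])
    with \<open>0 < ?r\<close> show ?thesis by simp
  qed
  show ?thesis
  proof
    show "pos_semidef ?R"
      unfolding pos_semidef_def
    proof (intro conjI allI)
      show "transpose ?R = ?R"
        using sym by (simp add: transpose_def vec_eq_iff mult.commute)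
      show "0 \<le> x \<bullet> (?R *v x)" for x
        using vle[of x] unfolding Rx by (simp add: inner_diff_right inner_commute power2_eq_square)
    qed
    show "?R *v ?e = 0"
    proof (cases "?r = 0")
      case True
      then have "(x \<bullet> (R *v ?e))\<^sup>2 \<le> 0" for x
        using pos_semidef_Cauchy_Schwarz[OF R, of x ?e] by simp
      then have "R *v ?e = 0"
        by (metis inner_eq_zero_iff power2_less_eq_zero_iff)
      then show ?thesis
        unfolding Rx using True by (simp add: v_def)
    next
      case False
      then show ?thesis unfolding Rx using r by (simp add: v_def inner_commute)
    qed
    \<comment> \<open>\<open>v\<close> is a multiple of \<open>R *v ?e\<close>, hence orthogonal to
      each \<open>axis k 1\<close> in the kernel of \<open>R\<close>. So earlier eliminations are
      not undone.\<close>
    show "?R *v axis k 1 = 0" if "R *v axis k 1 = 0" for k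
      unfolding Rx using that pos_semidef_inner_sym[OF R, of "axis k 1" ?e]
      by (simp add: v_def inner_commute)
  qed
qed

text \<open>Eliminating the coordinates one after another leaves a remainder that kills every basis
  vector and is therefore 0. Thus \<open>R\<close> is a sum of rank-one matrices
  \<open>outer (v i)\<close>, and the matrix with columns \<open>v i\<close> is a factor.\<close>

lemma pos_semidef_factorization:
  fixes R :: "real^'n^'n"
  assumes R: "pos_semidef R"
  shows "\<exists>A :: real^'n^'n. A ** transpose A = R"
proof -
  define outer :: "real^'n \<Rightarrow> real^'n^'n" where "outer v = (\<chi> j k. v $ j * v $ k)" for v
  have "\<exists>v. pos_semidef (R - (\<Sum>i\<in>S. outer (v i))) \<and>
     (\<forall>i\<in>S. (R - (\<Sum>i\<in>S. outer (v i))) *v axis i 1 = 0)" if "finite S" for S :: "'n set"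
    using that
  proof (induction S rule: finite_induct)
    case empty
    then show ?case using R by simp
  next
    case (insert i S)
    then obtain v where v: "pos_semidef (R - (\<Sum>i\<in>S. outer (v i)))"
     "\<And>i. i \<in> S \<Longrightarrow> (R - (\<Sum>i\<in>S. outer (v i))) *v axis i 1 = 0" by blast
    let ?R = "R - (\<Sum>i\<in>S. outer (v i))"
    obtain w where w: "pos_semidef (?R - outer w)" "(?R - outer w) *v axis i 1 = 0"
      "\<And>k. ?R *v axis k 1 = 0 \<Longrightarrow> (?R - outer w) *v axis k 1 = 0"
      using pos_semidef_eliminate[OF v(1), folded outer_def] by blast
    have "(\<Sum>l\<in>S. outer ((v(i:=w)) l)) = (\<Sum>i\<in>S. outer (v i))"
      using insert.hyps by (intro sum.cong) auto
    then have eq: "R - (\<Sum>l\<in>insert i S. outer ((v(i:=w)) l)) = ?R - outer w"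
      using insert.hyps by (simp add: algebra_simps)
    show ?case
      by (rule exI[of _ "v(i:=w)"], unfold eq) (use v w in blast)
  qed
  from this[OF finite[of UNIV]] obtain v :: "'n \<Rightarrow> real^'n" where
    v: "\<And>i. (R - (\<Sum>i\<in>UNIV. outer (v i))) *v axis i 1 = 0"
    by (meson UNIV_I)
  have "R $ j $ k = (\<Sum>i\<in>UNIV. outer (v i)) $ j $ k" for j k
    using arg_cong[OF v[of k], of "\<lambda>x. x $ j"] by (simp add: matrix_vector_mult_basis column_def)
  then have "(\<chi> j i. v i $ j) ** transpose (\<chi> j i. v i $ j) = R"
    by (simp add: vec_eq_iff matrix_matrix_mult_def transpose_def outer_def)
  then show ?thesis by blast
qed

section \<open>Reflections and families with equal Gram matrices\<close>

lemma orthogonal_transformation_reflection: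
  fixes w :: "'a::real_inner"
  shows "orthogonal_transformation (\<lambda>x. x - (2 * (w \<bullet> x) / (w \<bullet> w)) *\<^sub>R w)"
  unfolding orthogonal_transformation_def
proof (intro conjI allI)
  show "linear (\<lambda>x. x - (2 * (w \<bullet> x) / (w \<bullet> w)) *\<^sub>R w)"
    by (rule linearI) (simp_all add: inner_add_right algebra_simps add_divide_distrib scaleR_add_left)
  \<comment> \<open>The map is the reflection in the hyperplane orthogonal to \<open>w\<close>, and
    the identity when \<open>w = 0\<close>.\<close>
  show "(x - (2 * (w \<bullet> x) / (w \<bullet> w)) *\<^sub>R w) \<bullet> (y - (2 * (w \<bullet> y) / (w \<bullet> w)) *\<^sub>R w) = x \<bullet> y" for x y
    by (cases "w = 0") (simp_all add: inner_diff_left inner_diff_right inner_commute field_simps)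
qed

text \<open>Induction on the family: once \<open>f\<close> matches the earlier vectors, the
  reflection along \<open>w = f (a i) - b i\<close> moves \<open>f (a i)\<close> to
  \<open>b i\<close>, because both have the same norm. It fixes the earlier \<open>b j\<close>,
  which have the same inner product with both.\<close>

lemma orthogonal_transformation_of_equal_Gram:
  fixes a b :: "'i \<Rightarrow> 'a::real_inner"
  assumes "finite I" and Gram: "\<And>i j. i \<in> I \<Longrightarrow> j \<in> I \<Longrightarrow> a i \<bullet> a j = b i \<bullet> b j"
  shows "\<exists>f. orthogonal_transformation f \<and> (\<forall>i\<in>I. f (a i) = b i)"
  using assms
proof (induction I rule: finite_induct)
  case empty
  then show ?case using orthogonal_transformation_id by blast
next
  case (insert i I)
  then obtain f where f: "orthogonal_transformation f" and fa: "\<And>j. j \<in> I \<Longrightarrow> f (a j) = b j"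
    by auto
  have inner_f: "f x \<bullet> f y = x \<bullet> y" for x y
    using f by (simp add: orthogonal_transformation_def)
  define w where "w = f (a i) - b i"
  let ?g = "\<lambda>x. x - (2 * (w \<bullet> x) / (w \<bullet> w)) *\<^sub>R w"
  have "w \<bullet> b j = 0" if "j \<in> I" for j
    using inner_f[of "a i" "a j"] fa[OF that] insert.prems[of i j] that
    by (simp add: w_def inner_diff_left)
  then have gb: "?g (b j) = b j" if "j \<in> I" for j using that by simp
  \<comment> \<open>Equality of the norms of \<open>f (a i)\<close> and \<open>b i\<close>,
    rewritten so that the reflection subtracts exactly one copy of \<open>w\<close>.\<close>
  have ww: "w \<bullet> w = 2 * (w \<bullet> f (a i))"
    using inner_f[of "a i" "a i"] insert.prems[of i i]
    by (simp add: w_def inner_diff_left inner_diff_right inner_commute)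
  have "?g (f (a i)) = b i"
  proof (cases "w = 0")
    case True
    then show ?thesis by (simp add: w_def)
  next
    case False
    then have "2 * (w \<bullet> f (a i)) / (w \<bullet> w) = 1" using ww by (metis div_self inner_eq_zero_iff)
    then have "?g (f (a i)) = f (a i) - w" by (simp only: scaleR_one)
    then show ?thesis by (simp add: w_def)
  qed
  moreover have "orthogonal_transformation (?g \<circ> f)"
    using orthogonal_transformation_compose[OF orthogonal_transformation_reflection f] .
  moreover have "(?g \<circ> f) (a j) = b j" if "j \<in> I" for j
    using gb[OF that] fa[OF that] by simp
  ultimately show ?case
    by (metis (no_types, lifting) comp_apply insert_iff)
qed

section \<open>Half-line integrals of the standard normal density\<close>

text \<open>Domination by an absolute moment of the normal law: \<open>k = 0\<close> serves bounded
  integrands, \<open>k = 1\<close> the integrand obtained by differentiating in the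
  parameter.\<close>

lemma integrable_std_normal_density_half:
  fixes g :: "real \<Rightarrow> real"
  assumes [measurable]: "g \<in> borel_measurable borel" and "\<And>w. \<bar>g w\<bar> \<le> \<bar>w\<bar> ^ k"
  shows "integrable lborel (\<lambda>w. indicator {0<..} w * (std_normal_density w * g w))"
proof (rule Bochner_Integration.integrable_bound[OF integrable_std_normal_moment_abs[of k]])
  show "AE w in lborel. norm (indicator {0<..} w * (std_normal_density w * g w)) \<le>
    norm (std_normal_density w * \<bar>w\<bar> ^ k)"
  proof (rule AE_I2)
    fix w
    have "norm (indicator {0<..} w * (std_normal_density w * g w)) = indicator {0<..} w * (std_normal_density w * \<bar>g w\<bar>)"
      by (simp add: abs_mult)
    also have "\<dots> \<le> 1 * (std_normal_density w * \<bar>w\<bar> ^ k)"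
      using assms(2) by (intro mult_mono) (auto split: split_indicator)
    finally show "norm (indicator {0<..} w * (std_normal_density w * g w)) \<le> norm (std_normal_density w * \<bar>w\<bar> ^ k)"
      by simp
  qed
qed simp

text \<open>The hypotheses say \<open>f'' = -f\<close>, so that sine and cosine are treated at once: since
  \<open>\<phi>'(w) = -w \<phi>(w)\<close>, integrating \<open>w \<phi>(w) f'(s w)\<close> by parts gives a linear differential equation for \<open>F\<close>.\<close>

lemma DERIV_std_normal_half_transform:
  fixes f f' :: "real \<Rightarrow> real"
  assumes f: "\<And>x. (f has_real_derivative f' x) (at x)"
    and f': "\<And>x. (f' has_real_derivative - f x) (at x)"
    and bound: "\<And>x. \<bar>f x\<bar> \<le> 1" "\<And>x. \<bar>f' x\<bar> \<le> 1"
  defines "F \<equiv> \<lambda>s. \<integral>w. indicator {0<..} w * (std_normal_density w * f (s * w)) \<partial>lborel"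
  shows "(F has_real_derivative (f' 0 / sqrt (2 * pi) - s * F s)) (at s)"
proof -
  have cf: "continuous_on UNIV f" and cf': "continuous_on UNIV f'"
    using f f' by (meson DERIV_continuous_on DERIV_subset subset_UNIV)+
  have [measurable]: "f \<in> borel_measurable borel" "f' \<in> borel_measurable borel"
    using cf cf' by (auto intro: borel_measurable_continuous_onI)
  \<comment> \<open>The mean value bound supplies the majorant
    \<open>std_normal_density w * \<bar>w\<bar>\<close> for the difference quotients.\<close>
  have Lip: "\<bar>f x - f y\<bar> \<le> \<bar>x - y\<bar>" for x y
    using field_differentiable_bound[of UNIV f f' 1 x y] f bound by simp
  have int0: "integrable lborel (\<lambda>w. indicator {0<..} w * (std_normal_density w * f (s * w)))" for s
    by (rule integrable_std_normal_density_half[where k=0]) (use bound in auto)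
  have int1: "integrable lborel (\<lambda>w. indicator {0<..} w * (std_normal_density w * (w * f' (s * w))))" for s
  proof (rule integrable_std_normal_density_half[where k=1])
    show "\<bar>w * f' (s * w)\<bar> \<le> \<bar>w\<bar> ^ 1" for w
      using mult_left_mono[OF bound(2)[of "s * w"], of "\<bar>w\<bar>"] by (simp add: abs_mult)
  qed simp
  define D where "D = (\<integral>w. indicator {0<..} w * (std_normal_density w * (w * f' (s * w))) \<partial>lborel)"
  have "(F has_real_derivative D) (at s)"
    \<comment> \<open>The limit is taken along sequences so that dominated convergence
      applies.\<close>
    unfolding DERIV_def LIMSEQ_SEQ_conv[symmetric]
  proof (intro allI impI, elim conjE)
    fix X :: "nat \<Rightarrow> real" assume X: "\<forall>n. X n \<noteq> 0" and X0: "X \<longlonglongrightarrow> 0"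
    let ?q = "\<lambda>n w. indicator {0<..} w * (std_normal_density w * ((f ((s + X n) * w) - f (s * w)) / X n))"
    have "(F (s + X n) - F s) / X n = (\<integral>w. ?q n w \<partial>lborel)" for n
    proof -
      have "F (s + X n) - F s = (\<integral>w. indicator {0<..} w * (std_normal_density w * f ((s + X n) * w))
        - indicator {0<..} w * (std_normal_density w * f (s * w)) \<partial>lborel)"
        unfolding F_def by (rule Bochner_Integration.integral_diff[symmetric]) (rule int0)+
      then have "(F (s + X n) - F s) / X n = (\<integral>w. (indicator {0<..} w * (std_normal_density w * f ((s + X n) * w))
        - indicator {0<..} w * (std_normal_density w * f (s * w))) / X n \<partial>lborel)"
        by simp
      also have "\<dots> = (\<integral>w. ?q n w \<partial>lborel)"
        by (intro Bochner_Integration.integral_cong) (simp_all add: diff_divide_distrib right_diff_distrib)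
      finally show ?thesis .
    qed
    moreover have "(\<lambda>n. \<integral>w. ?q n w \<partial>lborel) \<longlonglongrightarrow> D"
      unfolding D_def
    proof (rule integral_dominated_convergence[where w="\<lambda>w. std_normal_density w * \<bar>w\<bar> ^ 1"])
      show "integrable lborel (\<lambda>w. std_normal_density w * \<bar>w\<bar> ^ 1)"
        by (rule integrable_std_normal_moment_abs)
      have "(\<lambda>n. (f ((s + X n) * w) - f (s * w)) / X n) \<longlonglongrightarrow> w * f' (s * w)" for w
      proof -
        have "((\<lambda>t. f (t * w)) has_real_derivative f' (s * w) * w) (at s)"
          by (rule DERIV_chain'[OF _ f]) (auto intro!: derivative_eq_intros)
        then have "(\<lambda>h. (f ((s + h) * w) - f (s * w)) / h) \<midarrow>0\<rightarrow> f' (s * w) * w"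
          by (simp add: DERIV_def)
        then show ?thesis using X X0 by (simp add: LIMSEQ_SEQ_conv[symmetric] mult.commute)
      qed
      then show "AE w in lborel. (\<lambda>n. ?q n w) \<longlonglongrightarrow>
          indicator {0<..} w * (std_normal_density w * (w * f' (s * w)))"
        by (intro AE_I2 tendsto_mult tendsto_const)
      show "AE w in lborel. norm (?q n w) \<le> std_normal_density w * \<bar>w\<bar> ^ 1" for n
      proof (rule AE_I2)
        fix w
        have "\<bar>f ((s + X n) * w) - f (s * w)\<bar> / \<bar>X n\<bar> \<le> \<bar>w\<bar>"
          using Lip[of "(s + X n) * w" "s * w"] X by (simp add: field_simps abs_mult[symmetric])
        then have "\<bar>(f ((s + X n) * w) - f (s * w)) / X n\<bar> \<le> \<bar>w\<bar>" by simp
        then have "indicator {0<..} w * (std_normal_density w * \<bar>(f ((s + X n) * w) - f (s * w)) / X n\<bar>) \<le>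
            1 * (std_normal_density w * \<bar>w\<bar>)"
          by (intro mult_mono) (auto split: split_indicator)
        then show "norm (?q n w) \<le> std_normal_density w * \<bar>w\<bar> ^ 1"
          by (simp add: abs_mult)
      qed
    qed simp_all
    ultimately show "(\<lambda>n. (F (s + X n) - F s) / X n) \<longlonglongrightarrow> D" by (simp only:)
  qed
  moreover have "D = f' 0 / sqrt (2 * pi) - s * F s"
  proof -
    \<comment> \<open>\<open>?G\<close> is an antiderivative of \<open>?g\<close>. The integral of
      \<open>?g\<close> over the half-line is \<open>D + s * F s\<close>, and the boundary values of
      \<open>?G\<close> are 0 at infinity and \<open>- f' 0 / sqrt (2 * pi)\<close> at 0.\<close>
    let ?G = "\<lambda>w. - std_normal_density w * f' (s * w)"
    let ?g = "\<lambda>w. std_normal_density w * (w * f' (s * w)) + s * (std_normal_density w * f (s * w))"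
    have ei: "einterval 0 \<infinity> = {0::real<..}" by (auto simp: einterval_def)
    have dG: "(?G has_real_derivative ?g w) (at w)" for w
    proof -
      have "((\<lambda>w. f' (s * w)) has_real_derivative - f (s * w) * s) (at w)"
        by (rule DERIV_chain'[OF _ f']) (auto intro!: derivative_eq_intros)
      moreover have "((\<lambda>w. c * exp (- w\<^sup>2 / 2)) has_real_derivative - w * (c * exp (- w\<^sup>2 / 2))) (at w)" for c :: real
        by (auto intro!: derivative_eq_intros)
      then have "(std_normal_density has_real_derivative - w * std_normal_density w) (at w)"
        unfolding std_normal_density_def .
      ultimately show ?thesis
        by (auto intro!: derivative_eq_intros)
    qed
    have cphi: "isCont std_normal_density w" for w
      unfolding std_normal_density_def by (intro continuous_intros) auto
    have cGf: "isCont f x" "isCont f' x" for x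
      using f f' DERIV_isCont by blast+
    have "(LBINT w=0..\<infinity>. ?g w) = 0 - ?G 0"
    proof (rule interval_integral_FTC_integrable)
      show "(?G has_vector_derivative ?g w) (at w)" for w
        using dG by (simp add: has_real_derivative_iff_has_vector_derivative)
      show "isCont ?g w" for w
        by (intro continuous_intros cphi isCont_o2[OF _ cGf(1)] isCont_o2[OF _ cGf(2)])
      show "set_integrable lborel (einterval 0 \<infinity>) ?g"
        using Bochner_Integration.integrable_add[OF int1[of s] integrable_mult_right[OF int0[of s], of s]]
        by (simp add: ei set_integrable_def algebra_simps)
      have "(?G \<longlongrightarrow> ?G 0) (at_right 0)"
        using DERIV_isCont[OF dG, of 0] by (simp add: isCont_def filterlim_at_split)
      then show "((?G \<circ> real_of_ereal) \<longlongrightarrow> ?G 0) (at_right 0)"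
        by (simp add: ereal_tendsto_simps zero_ereal_def)
      have "((\<lambda>w. std_normal_density w) \<longlongrightarrow> 0) at_top"
        unfolding std_normal_density_def by real_asymp
      then have "(?G \<longlongrightarrow> 0) at_top"
        by (rule Lim_null_comparison[rotated])
          (use bound(2) in \<open>auto intro!: always_eventually simp: abs_mult mult_left_le\<close>)
      then show "((?G \<circ> real_of_ereal) \<longlongrightarrow> 0) (at_left \<infinity>)"
        by (simp add: ereal_tendsto_simps)
    qed simp
    also have "0 - ?G 0 = f' 0 / sqrt (2 * pi)"
      by (simp add: std_normal_density_def)
    finally have "(LBINT w=0..\<infinity>. ?g w) = f' 0 / sqrt (2 * pi)" .
    moreover have "(LBINT w=0..\<infinity>. ?g w) = D + s * F s"
    proof -
      have "(LBINT w=0..\<infinity>. ?g w) = (\<integral>w. indicator {0<..} w * (std_normal_density w * (w * f' (s * w)))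
        + s * (indicator {0<..} w * (std_normal_density w * f (s * w))) \<partial>lborel)"
        by (simp add: interval_lebesgue_integral_def ei set_lebesgue_integral_def algebra_simps)
      also have "\<dots> = D + (\<integral>w. s * (indicator {0<..} w * (std_normal_density w * f (s * w))) \<partial>lborel)"
        unfolding D_def by (intro Bochner_Integration.integral_add int1 integrable_mult_right int0)
      finally show ?thesis by (simp add: F_def)
    qed
    ultimately show ?thesis by simp
  qed
  ultimately show ?thesis by simp
qed

section \<open>The function \<open>Im_fun\<close> and the half-line transforms\<close>

lemma DERIV_Im_fun: "(Im_fun has_real_derivative sqrt (2 / pi) * exp (x\<^sup>2 / 2)) (at x)"
proof -
  \<comment> \<open>The interval contains the base point 0 and has \<open>x\<close> in its interior,
    so the one-interval derivative is two-sided whatever the sign of \<open>x\<close>.\<close>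
  let ?a = "- \<bar>x\<bar> - 1" and ?b = "\<bar>x\<bar> + 1"
  have "((\<lambda>u. LBINT y=ereal 0..u. sqrt (2 / pi) * exp (y\<^sup>2 / 2)) has_vector_derivative
      sqrt (2 / pi) * exp (x\<^sup>2 / 2)) (at x within {?a..?b})"
    by (rule interval_integral_FTC2) (auto intro!: continuous_intros)
  moreover have "at x within {?a..?b} = at x"
    by (rule at_within_interior) (auto simp: abs_if)
  ultimately show ?thesis
    unfolding Im_fun_def[abs_def] has_real_derivative_iff_has_vector_derivative
    by (simp add: zero_ereal_def)
qed

lemma Im_fun_0: "Im_fun 0 = 0"
  by (simp add: Im_fun_def interval_lebesgue_integral_def einterval_def zero_ereal_def set_lebesgue_integral_def)

text \<open>By symmetry the two open half-lines carry equal mass; together they miss only the null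
  set containing 0.\<close>

lemma integral_std_normal_density_half:
  "(\<integral>w. indicator {0<..} w * std_normal_density w \<partial>lborel) = 1 / 2"
proof -
  let ?h = "\<lambda>w::real. indicator {0<..} w * std_normal_density w"
  have int: "integrable lborel ?h"
    using integrable_std_normal_density_half[of "\<lambda>_. 1" 0] by simp
  then have int': "integrable lborel (\<lambda>w. ?h (- w))"
    using lborel_integrable_real_affine_iff[of "-1" ?h 0] by simp
  have "(\<integral>w. ?h w \<partial>lborel) + (\<integral>w. ?h (- w) \<partial>lborel) = (\<integral>w. ?h w + ?h (- w) \<partial>lborel)"
    by (rule Bochner_Integration.integral_add[symmetric, OF int int'])
  also have "\<dots> = (\<integral>w. std_normal_density w \<partial>lborel)"
    by (rule integral_cong_AE)
      (use AE_lborel_singleton[of "0::real"] in \<open>auto split: split_indicator simp: std_normal_density_def elim!: eventually_mono\<close>)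
  also have "\<dots> = 1"
    by (simp add: integral_normal_density)
  also have "(\<integral>w. ?h (- w) \<partial>lborel) = (\<integral>w. ?h w \<partial>lborel)"
    using lborel_integral_real_affine[of "-1" ?h 0] by simp
  finally show ?thesis by simp
qed

text \<open>The integrating factor \<open>exp (s\<^sup>2 / 2)\<close> solves the differential
  equation: the derivative of \<open>exp (s\<^sup>2 / 2) * F s\<close> is that of
  \<open>f' 0 * Im_fun s / 2\<close>, so \<open>?H\<close> is constant, with value
  \<open>F 0 = f 0 / 2\<close>.\<close>

lemma std_normal_half_transform:
  fixes f f' :: "real \<Rightarrow> real"
  assumes f: "\<And>x. (f has_real_derivative f' x) (at x)"
    and f': "\<And>x. (f' has_real_derivative - f x) (at x)"
    and bound: "\<And>x. \<bar>f x\<bar> \<le> 1" "\<And>x. \<bar>f' x\<bar> \<le> 1"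
  shows "(\<integral>w. indicator {0<..} w * (std_normal_density w * f (s * w)) \<partial>lborel) =
    exp (- s\<^sup>2 / 2) * (f 0 + f' 0 * Im_fun s) / 2"
proof -
  define F where "F s = (\<integral>w. indicator {0<..} w * (std_normal_density w * f (s * w)) \<partial>lborel)" for s
  let ?H = "\<lambda>s. exp (s\<^sup>2 / 2) * F s - f' 0 * Im_fun s / 2"
  have sq: "sqrt (2 / pi) = 2 / sqrt (2 * pi)"
    by (simp add: real_sqrt_divide real_sqrt_mult field_simps)
  have "(?H has_real_derivative 0) (at s)" for s
    using DERIV_std_normal_half_transform[OF f f' bound, folded F_def, of s]
    by (auto intro!: derivative_eq_intros DERIV_Im_fun simp: F_def[abs_def] sq field_simps)
  then have "?H s = ?H 0" by (rule DERIV_isconst_all[OF allI])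
  moreover have "F 0 = f 0 / 2"
    using integral_std_normal_density_half by (simp add: F_def mult.assoc[symmetric])
  ultimately have "exp (s\<^sup>2 / 2) * F s = (f 0 + f' 0 * Im_fun s) / 2"
    by (simp add: Im_fun_0 field_simps)
  then have "F s = exp (- s\<^sup>2 / 2) * ((f 0 + f' 0 * Im_fun s) / 2)"
    by (simp add: exp_minus field_simps)
  then show ?thesis by (simp add: F_def)
qed

text \<open>Cosine has \<open>f 0 = 1\<close> and \<open>f' 0 = 0\<close>, sine the reverse, so they
  yield the real and the imaginary part. The closed half-line, which suits the events of a cdf,
  differs from the open one by a null set.\<close>

lemma std_normal_half_char:
  "(CLINT w|density lborel std_normal_density. indicator {0..} w * iexp (s * w)) =
    complex_of_real (exp (- s\<^sup>2 / 2) / 2) * (1 + \<i> * Im_fun s)"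
proof -
  let ?c = "\<lambda>w. indicator {0<..} w * (std_normal_density w * cos (s * w))"
  let ?s = "\<lambda>w. indicator {0<..} w * (std_normal_density w * sin (s * w))"
  have int: "integrable lborel ?c" "integrable lborel ?s"
    by (rule integrable_std_normal_density_half[where k=0]; simp)+
  have "(CLINT w|density lborel std_normal_density. indicator {0..} w * iexp (s * w)) =
    (CLINT w|lborel. std_normal_density w *\<^sub>R (indicator {0..} w * iexp (s * w)))"
    by (rule integral_density) auto
  also have "\<dots> = (CLINT w|lborel. complex_of_real (?c w) + \<i> * complex_of_real (?s w))"
    by (rule integral_cong_AE)
      (use AE_lborel_singleton[of "0::real"] in \<open>auto split: split_indicator simp: complex_eq_iff Re_exp Im_exp elim!: eventually_mono\<close>)
  also have "\<dots> = (CLINT w|lborel. complex_of_real (?c w)) + (CLINT w|lborel. \<i> * complex_of_real (?s w))"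
    using int by (intro Bochner_Integration.integral_add integrable_mult_right integrable_of_real)
  also have "\<dots> = complex_of_real (LINT w|lborel. ?c w) + \<i> * complex_of_real (LINT w|lborel. ?s w)"
    by (simp only: integral_mult_right_zero integral_complex_of_real)
  also have "(LINT w|lborel. ?c w) = exp (- s\<^sup>2 / 2) / 2"
    by (subst std_normal_half_transform[where f' = "\<lambda>x. - sin x"]) (auto intro!: derivative_eq_intros)
  also have "(LINT w|lborel. ?s w) = exp (- s\<^sup>2 / 2) * Im_fun s / 2"
    by (subst std_normal_half_transform[where f' = cos]) (auto intro!: derivative_eq_intros)
  finally show ?thesis
    by (simp add: algebra_simps)
qed

section \<open>The standard normal vector\<close>

lemma density_lborel_eq_distr_matrix:
  fixes B :: "real^'n^'n" and p :: "real^'n \<Rightarrow> ennreal"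
  assumes "det B \<noteq> 0" and [measurable]: "p \<in> borel_measurable borel"
  shows "density lborel p = distr (density lborel (\<lambda>z. ennreal \<bar>det B\<bar> * p (B *v z))) borel ((*v) B)"
proof -
  have [measurable]: "(*v) B \<in> borel_measurable borel"
    by (intro borel_measurable_continuous_onI continuous_intros)
  have "density lborel p = density (density (distr lborel borel ((*v) B)) (\<lambda>_. ennreal \<bar>det B\<bar>)) p"
    using lborel_eq_density_distr_matrix[OF assms(1)] by simp
  also have "\<dots> = density (distr lborel borel ((*v) B)) (\<lambda>x. ennreal \<bar>det B\<bar> * p x)"
    by (rule density_density_eq) simp_all
  also have "\<dots> = distr (density lborel (\<lambda>z. ennreal \<bar>det B\<bar> * p (B *v z))) borel ((*v) B)"
    by (rule density_distr) simp_all
  finally show ?thesis .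
qed

section \<open>Product densities and product integrals\<close>

lemma prod_std_normal_density:
  fixes z :: "real^'n"
  shows "(\<Prod>i\<in>UNIV. std_normal_density (z $ i)) = exp (- (z \<bullet> z) / 2) / sqrt ((2 * pi) ^ CARD('n))"
  by (simp add: std_normal_density_def prod.distrib prod_dividef inner_vec_def exp_sum[symmetric] sum_negf[symmetric]
    sum_divide_distrib real_sqrt_power real_sqrt_mult power_mult_distrib power2_eq_square)

lemma borel_measurable_prod_std_normal_density [measurable]:
  "(\<lambda>z::real^'n. ennreal (\<Prod>i\<in>UNIV. std_normal_density (z $ i))) \<in> borel_measurable borel"
  unfolding prod_std_normal_density by measurable

lemma sets_std_normal_vec [simp, measurable_cong]: "sets std_normal_vec = sets borel"
  by (simp add: std_normal_vec_def)

lemma space_std_normal_vec [simp]: "space std_normal_vec = UNIV"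
  by (simp add: std_normal_vec_def)

text \<open>Fubini over the coordinates: \<open>lborel\<close> is the image of the product measure
  indexed by \<open>Basis\<close>, and \<open>g\<close> relabels the factors by basis
  vectors.\<close>

lemma integral_lborel_prod_vec:
  fixes f :: "'n::finite \<Rightarrow> real \<Rightarrow> complex"
  assumes int: "\<And>i. integrable lborel (f i)"
  shows "(\<integral>z. (\<Prod>i\<in>UNIV. f i (z $ i)) \<partial>(lborel :: (real^'n) measure)) = (\<Prod>i\<in>UNIV. \<integral>x. f i x \<partial>lborel)"
proof -
  interpret product_sigma_finite "\<lambda>_ :: real^'n. lborel :: real measure" ..
  define g where "g b = f (THE i. b = axis i (1::real))" for b :: "real^'n"
  have g: "g (axis i 1) = f i" for i
    by (simp add: g_def axis_eq_axis)
  have gint: "integrable lborel (g b)" for b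
    by (simp add: g_def int)
  then have [measurable]: "g b \<in> borel_measurable borel" for b
    using borel_measurable_integrable by fastforce
  have "(\<integral>z. (\<Prod>i\<in>UNIV. f i (z $ i)) \<partial>(lborel :: (real^'n) measure)) =
      (\<integral>z. (\<Prod>b\<in>Basis. g b (z \<bullet> b)) \<partial>(lborel :: (real^'n) measure))"
    by (simp add: prod_Basis_vec g inner_axis)
  also have "\<dots> = (\<integral>h. (\<Prod>b\<in>Basis. g b ((\<Sum>b\<in>Basis. h b *\<^sub>R b) \<bullet> b)) \<partial>(\<Pi>\<^sub>M b\<in>Basis. lborel))"
    by (subst lborel_eq, rule integral_distr) measurable
  also have "\<dots> = (\<integral>h. (\<Prod>b\<in>Basis. g b (h b)) \<partial>(\<Pi>\<^sub>M b\<in>Basis. lborel))"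
    by (intro Bochner_Integration.integral_cong refl prod.cong arg_cong[where f = "g _"]) simp
  also have "\<dots> = (\<Prod>b\<in>Basis. \<integral>x. g b x \<partial>lborel)"
    by (rule product_integral_prod) (auto simp: gint)
  also have "\<dots> = (\<Prod>i\<in>UNIV. \<integral>x. f i x \<partial>lborel)"
    by (simp add: prod_Basis_vec g)
  finally show ?thesis .
qed

lemma integral_std_normal_vec_prod:
  fixes f :: "'n::finite \<Rightarrow> real \<Rightarrow> complex"
  assumes int: "\<And>i. integrable std_normal_distribution (f i)"
  shows "(\<integral>z. (\<Prod>i\<in>UNIV. f i (z $ i)) \<partial>(std_normal_vec :: (real^'n) measure)) =
    (\<Prod>i\<in>UNIV. \<integral>x. f i x \<partial>std_normal_distribution)"
proof -
  have [measurable]: "f i \<in> borel_measurable borel" for i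
    using borel_measurable_integrable[OF int[of i]] by simp
  have int': "integrable lborel (\<lambda>x. std_normal_density x *\<^sub>R f i x)" for i
    using int[of i] by (simp add: integrable_density)
  have "(\<integral>z. (\<Prod>i\<in>UNIV. f i (z $ i)) \<partial>(std_normal_vec :: (real^'n) measure)) =
     (\<integral>z. (\<Prod>i\<in>UNIV. std_normal_density (z $ i)) *\<^sub>R (\<Prod>i\<in>UNIV. f i (z $ i)) \<partial>(lborel :: (real^'n) measure))"
    unfolding std_normal_vec_def
    by (rule integral_density) (auto intro!: prod_nonneg borel_measurable_prod borel_measurable_times)
  also have "\<dots> = (\<integral>z. (\<Prod>i\<in>UNIV. std_normal_density (z $ i) *\<^sub>R f i (z $ i)) \<partial>(lborel :: (real^'n) measure))"
    by (simp add: scaleR_conv_of_real prod.distrib of_real_prod)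
  also have "\<dots> = (\<Prod>i\<in>UNIV. \<integral>x. std_normal_density x *\<^sub>R f i x \<partial>lborel)"
    using integral_lborel_prod_vec[OF int'] .
  also have "\<dots> = (\<Prod>i\<in>UNIV. \<integral>x. f i x \<partial>std_normal_distribution)"
    by (simp add: integral_density)
  finally show ?thesis .
qed

lemma prob_space_std_normal_vec: "prob_space (std_normal_vec :: (real^'n) measure)"
proof
  have 1: "(\<integral>\<^sup>+x. ennreal (std_normal_density x) \<partial>lborel) = 1"
    using prob_space.emeasure_space_1[OF prob_space_normal_density[of 1 0]] by (simp add: emeasure_density)
  have "emeasure (std_normal_vec :: (real^'n) measure) UNIV =
      (\<integral>\<^sup>+z. ennreal (\<Prod>i\<in>UNIV. std_normal_density (z $ i)) \<partial>(lborel :: (real^'n) measure))"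
    by (simp add: std_normal_vec_def emeasure_density)
  also have "\<dots> = (\<integral>\<^sup>+z. (\<Prod>b\<in>Basis. ennreal (std_normal_density (z \<bullet> b))) \<partial>(lborel :: (real^'n) measure))"
    by (simp add: prod_Basis_vec inner_axis prod_ennreal)
  also have "\<dots> = 1"
    by (subst nn_integral_lborel_prod) (simp_all add: 1)
  finally show "emeasure (std_normal_vec :: (real^'n) measure) (space std_normal_vec) = 1" by simp
qed

lemma distr_std_normal_vec_orthogonal:
  fixes f :: "real^'n \<Rightarrow> real^'n"
  assumes f: "orthogonal_transformation f"
  shows "distr std_normal_vec borel f = std_normal_vec"
proof -
  let ?B = "matrix f"
  have det: "\<bar>det ?B\<bar> = 1" using f by simp
  then have "det ?B \<noteq> 0" by auto
  have fB: "(*v) ?B = f"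
    using f by (simp add: orthogonal_transformation_linear matrix_works fun_eq_iff)
  \<comment> \<open>The density depends only on \<open>z \<bullet> z\<close>, which \<open>f\<close>
    preserves, and the Jacobian factor is 1.\<close>
  have "std_normal_vec = distr std_normal_vec borel ((*v) ?B)"
    unfolding std_normal_vec_def
    by (subst density_lborel_eq_distr_matrix[OF \<open>det ?B \<noteq> 0\<close>])
      (use det f in \<open>auto simp: fB prod_std_normal_density orthogonal_transformation_def\<close>)
  then show ?thesis by (simp add: fB)
qed

text \<open>An orthogonal \<open>f\<close> with \<open>f (a i) = b i\<close> turns
  \<open>a i \<bullet> v\<close> into \<open>b i \<bullet> f v\<close>, and \<open>f\<close>
  preserves the standard normal law.\<close>

lemma integral_std_normal_vec_equal_Gram:
  fixes a b :: "'i::finite \<Rightarrow> real^'n" and G :: "('i \<Rightarrow> real) \<Rightarrow> complex"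
  assumes Gram: "\<And>i j. a i \<bullet> a j = b i \<bullet> b j"
    and [measurable]: "(\<lambda>v. G (\<lambda>i. b i \<bullet> v)) \<in> borel_measurable borel"
  shows "(\<integral>v. G (\<lambda>i. a i \<bullet> v) \<partial>std_normal_vec) = (\<integral>v. G (\<lambda>i. b i \<bullet> v) \<partial>std_normal_vec)"
proof -
  obtain f where f: "orthogonal_transformation f" and fa: "\<And>i. f (a i) = b i"
    using orthogonal_transformation_of_equal_Gram[of UNIV a b] Gram by auto
  have [measurable]: "f \<in> borel_measurable borel"
    using f by (simp add: borel_measurable_continuous_onI linear_continuous_on linear_linear
      orthogonal_transformation_linear)
  have "a i \<bullet> v = b i \<bullet> f v" for i v
    using f by (simp add: fa[symmetric] orthogonal_transformation_def)
  then have "(\<integral>v. G (\<lambda>i. a i \<bullet> v) \<partial>std_normal_vec) = (\<integral>v. G (\<lambda>i. b i \<bullet> f v) \<partial>std_normal_vec)"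
    by simp
  also have "\<dots> = (\<integral>v. G (\<lambda>i. b i \<bullet> v) \<partial>distr std_normal_vec borel f)"
    by (rule integral_distr[symmetric]) simp_all
  finally show ?thesis by (simp add: distr_std_normal_vec_orthogonal[OF f])
qed

section \<open>Independent standard normal vectors as one vector\<close>

text \<open>Two independent vectors become one vector over the sum of the index types, so that
  rotation invariance can mix the coordinates of both.\<close>

definition vec_join :: "real^'n \<Rightarrow> real^'m \<Rightarrow> real^('n + 'm)" where
  "vec_join x y = (\<chi> k. case k of Inl i \<Rightarrow> x $ i | Inr j \<Rightarrow> y $ j)"

lemma vec_join_nth [simp]: "vec_join x y $ Inl i = x $ i" "vec_join x y $ Inr j = y $ j"
  by (simp_all add: vec_join_def)

lemma prod_UNIV_Plus:
  fixes f :: "'a::finite + 'b::finite \<Rightarrow> 'c::comm_monoid_mult"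
  shows "(\<Prod>k\<in>UNIV. f k) = (\<Prod>i\<in>UNIV. f (Inl i)) * (\<Prod>j\<in>UNIV. f (Inr j))"
  by (simp add: UNIV_Plus_UNIV[symmetric] prod.Plus del: UNIV_Plus_UNIV)

lemma sum_UNIV_Plus:
  fixes f :: "'a::finite + 'b::finite \<Rightarrow> 'c::comm_monoid_add"
  shows "(\<Sum>k\<in>UNIV. f k) = (\<Sum>i\<in>UNIV. f (Inl i)) + (\<Sum>j\<in>UNIV. f (Inr j))"
  by (simp add: UNIV_Plus_UNIV[symmetric] sum.Plus del: UNIV_Plus_UNIV)

lemma inner_vec_join: "vec_join x y \<bullet> vec_join x' y' = x \<bullet> x' + y \<bullet> y'"
  by (simp add: inner_vec_def sum_UNIV_Plus)

lemma borel_measurable_vec_join [measurable]: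
  "(\<lambda>(x, y). vec_join x y) \<in> borel_measurable (borel \<Otimes>\<^sub>M borel)"
proof -
  have "continuous_on UNIV (\<lambda>(x :: real^'n, y :: real^'m). vec_join x y)"
    unfolding vec_join_def case_prod_beta
  proof (rule continuous_on_vec_lambda)
    show "continuous_on UNIV (\<lambda>w :: (real^'n) \<times> (real^'m). case k of Inl i \<Rightarrow> fst w $ i | Inr j \<Rightarrow> snd w $ j)" for k
      by (cases k) (auto intro!: continuous_intros)
  qed
  then show ?thesis
    unfolding borel_prod by (rule borel_measurable_continuous_onI)
qed

lemma emeasure_lborel_box_cart:
  fixes l u :: "real^'n"
  assumes "\<And>i. l $ i \<le> u $ i"
  shows "emeasure lborel (box l u) = ennreal (\<Prod>i\<in>UNIV. u $ i - l $ i)"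
proof -
  have "l \<bullet> b \<le> u \<bullet> b" if "b \<in> Basis" for b
    using that assms by (auto simp: Basis_vec_def inner_axis)
  then show ?thesis by (simp add: prod_Basis_vec inner_axis)
qed

text \<open>A box in the joined space is the product of two boxes, and the product of its side
  lengths splits accordingly.\<close>

lemma distr_lborel_vec_join:
  "distr (lborel \<Otimes>\<^sub>M lborel) borel (\<lambda>(x :: real^'n, y :: real^'m). vec_join x y) = lborel"
proof (rule lborel_eqI[symmetric])
  fix l u :: "real^('n + 'm)"
  assume le: "\<And>b. b \<in> Basis \<Longrightarrow> l \<bullet> b \<le> u \<bullet> b"
  have le': "l $ k \<le> u $ k" for k
    using le[of "axis k 1"] by (simp add: inner_axis)
  let ?l1 = "(\<chi> i. l $ Inl i) :: real^'n" and ?u1 = "(\<chi> i. u $ Inl i) :: real^'n"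
  let ?l2 = "(\<chi> i. l $ Inr i) :: real^'m" and ?u2 = "(\<chi> i. u $ Inr i) :: real^'m"
  have vim: "(\<lambda>(x, y). vec_join x y) -` box l u = box ?l1 ?u1 \<times> box ?l2 ?u2"
    by (auto simp: mem_box_cart split_sum_all)
  have "emeasure (distr (lborel \<Otimes>\<^sub>M lborel) borel (\<lambda>(x :: real^'n, y :: real^'m). vec_join x y)) (box l u) =
      emeasure (lborel \<Otimes>\<^sub>M lborel) (box ?l1 ?u1 \<times> box ?l2 ?u2)"
    by (subst emeasure_distr) (simp_all add: vim space_pair_measure)
  also have "\<dots> = emeasure lborel (box ?l1 ?u1) * emeasure lborel (box ?l2 ?u2)"
    by (rule lborel.emeasure_pair_measure_Times) simp_all
  also have "\<dots> = ennreal (\<Prod>i\<in>UNIV. u $ Inl i - l $ Inl i) * ennreal (\<Prod>i\<in>UNIV. u $ Inr i - l $ Inr i)"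
    by (simp add: emeasure_lborel_box_cart le')
  also have "\<dots> = ennreal (\<Prod>b\<in>Basis. (u - l) \<bullet> b)"
    by (simp add: ennreal_mult[symmetric] prod_nonneg le' prod_Basis_vec inner_axis prod_UNIV_Plus)
  finally show "emeasure (distr (lborel \<Otimes>\<^sub>M lborel) borel (\<lambda>(x :: real^'n, y :: real^'m). vec_join x y)) (box l u) =
    ennreal (\<Prod>b\<in>Basis. (u - l) \<bullet> b)" .
qed simp

lemma distr_std_normal_vec_join:
  "distr (std_normal_vec \<Otimes>\<^sub>M std_normal_vec) borel (\<lambda>(x :: real^'n, y :: real^'m). vec_join x y) = std_normal_vec"
proof -
  let ?p = "\<lambda>z. ennreal (\<Prod>i\<in>UNIV. std_normal_density (z $ i))"
  interpret prob_space "std_normal_vec :: (real^'m) measure" by (rule prob_space_std_normal_vec)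
  have "(std_normal_vec :: (real^'n) measure) \<Otimes>\<^sub>M (std_normal_vec :: (real^'m) measure) =
      density (lborel \<Otimes>\<^sub>M lborel) (\<lambda>(x, y). ?p x * ?p y)"
    using sigma_finite_measure_axioms unfolding std_normal_vec_def
    by (intro pair_measure_density) (auto intro: lborel.sigma_finite_measure_axioms)
  \<comment> \<open>The product density is the standard normal density evaluated at the joined
    vector.\<close>
  also have "(\<lambda>(x :: real^'n, y :: real^'m). ?p x * ?p y) = (\<lambda>w. ?p ((\<lambda>(x, y). vec_join x y) w))"
    by (auto simp: fun_eq_iff prod_UNIV_Plus ennreal_mult[symmetric] prod_nonneg)
  finally have "distr (std_normal_vec \<Otimes>\<^sub>M std_normal_vec) borel (\<lambda>(x :: real^'n, y :: real^'m). vec_join x y) =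
      density (distr (lborel \<Otimes>\<^sub>M lborel) borel (\<lambda>(x :: real^'n, y :: real^'m). vec_join x y)) ?p"
    by (simp add: density_distr)
  then show ?thesis
    by (simp add: distr_lborel_vec_join std_normal_vec_def)
qed

section \<open>Positive definite matrices and the nondegenerate normal law\<close>

lemma matrix_inv_inverse:
  fixes A :: "real^'n^'n"
  assumes "invertible A"
  shows "A ** matrix_inv A = mat 1" "matrix_inv A ** A = mat 1"
  using someI_ex[of "\<lambda>A'. A ** A' = mat 1 \<and> A' ** A = mat 1"] assms
  unfolding invertible_def matrix_inv_def by blast+

lemma pos_def_invertible:
  fixes A :: "real^'n^'n"
  assumes "pos_def A"
  shows "invertible A"
proof -
  have "x = 0" if "A *v x = 0" for x
    using assms that by (force simp: pos_def_def)
  then show ?thesis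
    by (metis invertible_left_inverse matrix_left_invertible_ker)
qed

lemma pos_def_imp_pos_semidef: "pos_def A \<Longrightarrow> pos_semidef A"
  unfolding pos_def_def pos_semidef_def by (metis inner_zero_left order_less_imp_le order_refl)

text \<open>Substituting \<open>x = S *v z\<close>, the quadratic form becomes
  \<open>z \<bullet> z\<close>, because \<open>transpose S ** (matrix_inv \<Omega> ** S)\<close> is
  the identity. The Jacobian \<open>\<bar>det S\<bar>\<close> cancels the root of
  \<open>det \<Omega> = det S * det S\<close>.\<close>

lemma density_normal_pdf:
  fixes S \<Omega> :: "real^'n^'n"
  assumes \<Omega>: "pos_def \<Omega>" and S: "S ** transpose S = \<Omega>"
  shows "density lborel (\<lambda>x. ennreal (normal_pdf \<Omega> x)) = distr std_normal_vec borel ((*v) S)"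
proof -
  have inv: "invertible \<Omega>" using \<Omega> by (rule pos_def_invertible)
  have det\<Omega>: "det \<Omega> = det S * det S" unfolding S[symmetric] by (simp add: det_mul)
  then have detS: "det S \<noteq> 0" using inv by (auto simp: invertible_det_nz)
  then obtain T where T: "S ** T = mat 1" "T ** S = mat 1"
    by (auto simp: invertible_det_nz[symmetric] invertible_def)
  have "transpose S ** (matrix_inv \<Omega> ** S) = (T ** S) ** (transpose S ** (matrix_inv \<Omega> ** S))"
    by (simp add: T)
  also have "\<dots> = T ** ((S ** transpose S) ** matrix_inv \<Omega>) ** S"
    by (simp only: matrix_mul_assoc)
  also have "\<dots> = mat 1"
    by (simp add: S matrix_inv_inverse[OF inv] T)
  finally have 1: "transpose S ** (matrix_inv \<Omega> ** S) = mat 1" .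
  have quad: "(S *v z) \<bullet> (matrix_inv \<Omega> *v (S *v z)) = z \<bullet> z" for z
  proof -
    have "(S *v z) \<bullet> (matrix_inv \<Omega> *v (S *v z)) = z \<bullet> ((transpose S ** (matrix_inv \<Omega> ** S)) *v z)"
      by (metis dot_lmul_matrix matrix_vector_mul_assoc vector_transpose_matrix inner_commute transpose_matrix_vector)
    then show ?thesis by (simp add: 1)
  qed
  have "\<bar>det S\<bar> * normal_pdf \<Omega> (S *v z) = (\<Prod>i\<in>UNIV. std_normal_density (z $ i))" for z
    using detS by (simp add: normal_pdf_def quad prod_std_normal_density det\<Omega> real_sqrt_mult real_sqrt_abs2)
  then have "ennreal \<bar>det S\<bar> * ennreal (normal_pdf \<Omega> (S *v z)) = ennreal (\<Prod>i\<in>UNIV. std_normal_density (z $ i))" for z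
    by (metis abs_ge_zero ennreal_mult')
  moreover have "(\<lambda>x. ennreal (normal_pdf \<Omega> x)) \<in> borel_measurable borel"
    unfolding normal_pdf_def
    by (intro measurable_compose[OF _ measurable_ennreal] borel_measurable_continuous_onI continuous_intros) (auto simp: det\<Omega> detS)
  ultimately show ?thesis
    by (simp add: density_lborel_eq_distr_matrix[OF detS] std_normal_vec_def)
qed

section \<open>The characteristic function\<close>

lemma transpose_matrix_inv:
  fixes A :: "real^'n^'n"
  assumes "pos_def A"
  shows "transpose (matrix_inv A) = matrix_inv A"
proof -
  have "transpose A = A" using assms by (simp add: pos_def_def)
  then show ?thesis
    using matrix_inv_inverse[OF pos_def_invertible[OF assms]]
    by (metis matrix_mul_assoc matrix_mul_lid matrix_mul_rid matrix_transpose_mul transpose_mat)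
qed

text \<open>For \<open>x = ?V *v (\<Lambda> *v y)\<close> and
  \<open>?q = x \<bullet> (\<Omega> *v x)\<close>, Cauchy-Schwarz bounds the square of
  \<open>?q\<close> by \<open>y \<bullet> y\<close> times the squared norm of
  \<open>transpose \<Lambda> *v x\<close>. Admissibility bounds that squared norm by
  \<open>?q\<close>. Hence \<open>?q \<le> y \<bullet> y\<close>, and the difference is the form of
  \<open>cfusn_Delta\<close>.\<close>

lemma cfusn_Delta_pos_semidef:
  fixes \<Omega> \<Lambda> :: "real^'n^'n"
  assumes "cfusn_admissible \<mu> \<Omega> \<Lambda>"
  shows "pos_semidef (cfusn_Delta \<Omega> \<Lambda>)"
proof -
  have \<Omega>: "pos_def \<Omega>" and \<Gamma>: "pos_semidef (\<Omega> - \<Lambda> ** transpose \<Lambda>)"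
    using assms by (auto simp: cfusn_admissible_def)
  let ?V = "matrix_inv \<Omega>"
  note inv = matrix_inv_inverse[OF pos_def_invertible[OF \<Omega>]]
  have symV: "transpose ?V = ?V" using \<Omega> by (rule transpose_matrix_inv)
  show ?thesis
    unfolding pos_semidef_def
  proof (intro conjI allI)
    show "transpose (cfusn_Delta \<Omega> \<Lambda>) = cfusn_Delta \<Omega> \<Lambda>"
    proof -
      have "transpose (mat 1 - M) = mat 1 - transpose M" for M :: "real^'n^'n"
        by (simp add: transpose_def vec_eq_iff mat_def)
      then show ?thesis
        by (simp add: cfusn_Delta_def matrix_transpose_mul symV matrix_mul_assoc)
    qed
    fix y :: "real^'n"
    define x where "x = ?V *v (\<Lambda> *v y)"
    have \<Omega>x: "\<Omega> *v x = \<Lambda> *v y"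
      by (simp add: x_def matrix_vector_mul_assoc inv matrix_mul_assoc)
    let ?q = "x \<bullet> (\<Omega> *v x)"
    have q0: "0 \<le> ?q" using pos_def_imp_pos_semidef[OF \<Omega>] by (simp add: pos_semidef_def)
    have q: "?q = (transpose \<Lambda> *v x) \<bullet> y"
      unfolding \<Omega>x by (simp add: dot_lmul_matrix)
    have le: "(transpose \<Lambda> *v x) \<bullet> (transpose \<Lambda> *v x) \<le> ?q"
    proof -
      have "0 \<le> x \<bullet> ((\<Omega> - \<Lambda> ** transpose \<Lambda>) *v x)"
        using \<Gamma> by (simp add: pos_semidef_def)
      also have "\<dots> = ?q - x \<bullet> (\<Lambda> *v (transpose \<Lambda> *v x))"
        by (simp only: matrix_vector_mult_diff_rdistrib inner_diff_right matrix_vector_mul_assoc)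
      also have "x \<bullet> (\<Lambda> *v (transpose \<Lambda> *v x)) = (transpose \<Lambda> *v x) \<bullet> (transpose \<Lambda> *v x)"
        by (simp add: dot_lmul_matrix)
      finally show ?thesis by simp
    qed
    have "?q\<^sup>2 \<le> ?q * (y \<bullet> y)"
    proof -
      have "?q\<^sup>2 \<le> ((transpose \<Lambda> *v x) \<bullet> (transpose \<Lambda> *v x)) * (y \<bullet> y)"
        unfolding q by (rule Cauchy_Schwarz_ineq)
      also have "\<dots> \<le> ?q * (y \<bullet> y)"
        using le by (intro mult_right_mono) auto
      finally show ?thesis .
    qed
    then have "?q \<le> y \<bullet> y"
      using q0 by (cases "?q = 0") (auto simp: power2_eq_square)
    moreover have "y \<bullet> (cfusn_Delta \<Omega> \<Lambda> *v y) = y \<bullet> y - ?q"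
    proof -
      have "cfusn_Delta \<Omega> \<Lambda> *v y = y - transpose \<Lambda> *v x"
        by (simp add: cfusn_Delta_def x_def matrix_vector_mult_diff_rdistrib matrix_vector_mul_assoc matrix_mul_assoc
          del: transpose_matrix_vector)
      then show ?thesis
        using q by (simp only: inner_diff_right inner_commute)
    qed
    ultimately show "0 \<le> y \<bullet> (cfusn_Delta \<Omega> \<Lambda> *v y)" by simp
  qed
qed

lemma borel_measurable_matrix_vector_mult [measurable]:
  fixes A :: "real^'n^'m"
  assumes [measurable]: "f \<in> borel_measurable M"
  shows "(\<lambda>x. A *v f x) \<in> borel_measurable M"
proof -
  have [measurable]: "(*v) A \<in> borel_measurable borel"
    by (intro borel_measurable_continuous_onI continuous_intros)
  show ?thesis by measurable
qed

text \<open>Names the factor chosen in \<open>normal_law\<close>. The choice satisfies its defining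
  equation because a positive semi-definite matrix can be factorized.\<close>

lemma normal_cdf_eq_integral:
  fixes \<Sigma> :: "real^'n^'n"
  assumes "pos_semidef \<Sigma>"
  obtains D :: "real^'n^'n" where "D ** transpose D = \<Sigma>"
    "\<And>y. normal_cdf \<Sigma> y = (\<integral>z. indicator {z. \<forall>i. (D *v z) $ i \<le> y $ i} z \<partial>std_normal_vec)"
proof
  let ?D = "SOME A::real^'n^'n. A ** transpose A = \<Sigma>"
  show "?D ** transpose ?D = \<Sigma>"
    using pos_semidef_factorization[OF assms] by (rule someI_ex)
  show "normal_cdf \<Sigma> y = (\<integral>z. indicator {z. \<forall>i. (?D *v z) $ i \<le> y $ i} z \<partial>std_normal_vec)" for y
  proof -
    have "{z::real^'n. \<forall>i. z $ i \<le> y $ i} \<in> sets borel" by measurable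
    then show ?thesis
      by (simp add: normal_cdf_def normal_law_def measure_distr vimage_def)
  qed
qed

text \<open>The integrand is a product over coordinates. The first block gives the half-line
  transforms; the second gives normal characteristic functions, equal to
  \<open>exp (- c\<^sup>2 / 2)\<close> at \<open>j0\<close> and to 1 elsewhere.\<close>

lemma integral_std_normal_vec_half_char:
  fixes s :: "real^'n" and c :: real and j0 :: "'m::finite"
  shows "(CLINT v|(std_normal_vec :: (real^('n + 'm)) measure).
      indicator {v. \<forall>i. 0 \<le> v $ Inl i} v * iexp (vec_join s (axis j0 c) \<bullet> v)) =
    complex_of_real (exp (- (s \<bullet> s + c\<^sup>2) / 2)) * (\<Prod>i\<in>UNIV. (1 + \<i> * Im_fun (s $ i)) / 2)"
proof -
  define g :: "'n + 'm \<Rightarrow> real \<Rightarrow> complex" where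
    "g k w = (case k of Inl i \<Rightarrow> indicator {0..} w * iexp (s $ i * w) | Inr j \<Rightarrow> iexp (axis j0 c $ j * w))" for k w
  interpret N: prob_space std_normal_distribution by (rule prob_space_normal_density) simp
  have int: "integrable std_normal_distribution (g k)" for k
    by (rule N.integrable_const_bound[where B=1]; cases k)
      (auto simp: g_def[abs_def] norm_mult split: split_indicator)
  have "indicator {v. \<forall>i. 0 \<le> v $ Inl i} v * iexp (vec_join s (axis j0 c) \<bullet> v) = (\<Prod>k\<in>UNIV. g k (v $ k))"
    for v :: "real^('n + 'm)"
  proof -
    have ind: "indicator {v. \<forall>i. 0 \<le> v $ Inl i} v = (\<Prod>i\<in>UNIV. indicator {0..} (v $ Inl i) :: complex)"
      by (auto simp: indicator_def)
    have "vec_join s (axis j0 c) \<bullet> v = (\<Sum>i\<in>UNIV. s $ i * v $ Inl i) + (\<Sum>j\<in>UNIV. axis j0 c $ j * v $ Inr j)"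
      by (simp add: inner_vec_def sum_UNIV_Plus)
    then show ?thesis
      by (simp add: ind g_def prod_UNIV_Plus prod.distrib exp_sum exp_add sum_distrib_left distrib_left)
  qed
  then have "(CLINT v|(std_normal_vec :: (real^('n + 'm)) measure).
      indicator {v. \<forall>i. 0 \<le> v $ Inl i} v * iexp (vec_join s (axis j0 c) \<bullet> v)) =
      (\<Prod>k\<in>UNIV. CLINT w|std_normal_distribution. g k w)"
    by (simp only: integral_std_normal_vec_prod[OF int])
  also have "\<dots> = (\<Prod>i\<in>UNIV. complex_of_real (exp (- (s $ i)\<^sup>2 / 2)) * ((1 + \<i> * Im_fun (s $ i)) / 2)) *
      (\<Prod>j\<in>UNIV. complex_of_real (exp (- (axis j0 c $ j)\<^sup>2 / 2)))"
  proof -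
    have "(CLINT w|std_normal_distribution. g (Inl i) w) =
        complex_of_real (exp (- (s $ i)\<^sup>2 / 2)) * ((1 + \<i> * Im_fun (s $ i)) / 2)" for i
      unfolding g_def sum.case std_normal_half_char by simp
    moreover have "(CLINT w|std_normal_distribution. g (Inr j) w) =
        complex_of_real (exp (- (axis j0 c $ j)\<^sup>2 / 2))" for j
      using fun_cong[OF char_std_normal_distribution, of "axis j0 c $ j"] by (simp add: char_def g_def)
    ultimately show ?thesis
      by (simp only: prod_UNIV_Plus)
  qed
  also have "(\<Prod>j\<in>UNIV. complex_of_real (exp (- (axis j0 c $ j)\<^sup>2 / 2))) = complex_of_real (exp (- c\<^sup>2 / 2))"
  proof -
    have "(\<Prod>j\<in>UNIV. complex_of_real (exp (- (axis j0 c $ j)\<^sup>2 / 2))) =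
        (\<Prod>j\<in>UNIV. if j = j0 then complex_of_real (exp (- c\<^sup>2 / 2)) else 1)"
      by (rule prod.cong) (auto simp: axis_def)
    then show ?thesis by simp
  qed
  also have "(\<Prod>i\<in>UNIV. complex_of_real (exp (- (s $ i)\<^sup>2 / 2)) * ((1 + \<i> * Im_fun (s $ i)) / 2)) =
      complex_of_real (exp (- (s \<bullet> s) / 2)) * (\<Prod>i\<in>UNIV. (1 + \<i> * Im_fun (s $ i)) / 2)"
    unfolding prod.distrib
    by (simp add: of_real_prod[symmetric] exp_sum[symmetric] sum_negf[symmetric] sum_divide_distrib inner_vec_def power2_eq_square
      del: of_real_prod)
  finally have "(CLINT v|(std_normal_vec :: (real^('n + 'm)) measure).
      indicator {v. \<forall>i. 0 \<le> v $ Inl i} v * iexp (vec_join s (axis j0 c) \<bullet> v)) =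
    complex_of_real (exp (- (s \<bullet> s) / 2)) * (\<Prod>i\<in>UNIV. (1 + \<i> * Im_fun (s $ i)) / 2) *
    complex_of_real (exp (- c\<^sup>2 / 2))" .
  moreover have "exp (- (s \<bullet> s + c\<^sup>2) / 2) = exp (- (s \<bullet> s) / 2) * exp (- c\<^sup>2 / 2)"
    by (simp only: exp_add[symmetric] add_divide_distrib minus_add_distrib)
  ultimately show ?thesis
    by (simp only: of_real_mult mult_ac)
qed

theorem theorem4:
  fixes \<mu> :: "real^'n" and \<Omega> \<Lambda> :: "real^'n^'n"
  assumes "cfusn_admissible \<mu> \<Omega> \<Lambda>"
  shows "\<forall>t. char_vec (CFUSN \<mu> \<Omega> \<Lambda>) t =
    exp (\<i> * complex_of_real (t \<bullet> \<mu>) - complex_of_real (t \<bullet> (\<Omega> *v t)) / 2) *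
    (\<Prod>i\<in>UNIV. (1 + \<i> * complex_of_real (Im_fun (column i \<Lambda> \<bullet> t))))"
proof
  fix t
  let ?\<gamma> = "std_normal_vec :: (real^'n) measure"
  let ?V = "matrix_inv \<Omega>"
  interpret \<gamma>: prob_space ?\<gamma> by (rule prob_space_std_normal_vec)
  interpret \<gamma>2: pair_prob_space ?\<gamma> ?\<gamma> ..
  have \<Omega>: "pos_def \<Omega>" and \<Gamma>: "pos_semidef (\<Omega> - \<Lambda> ** transpose \<Lambda>)"
    using assms by (auto simp: cfusn_admissible_def)
  note inv = matrix_inv_inverse[OF pos_def_invertible[OF \<Omega>]]
  have symV: "transpose ?V = ?V" using \<Omega> by (rule transpose_matrix_inv)
  obtain S :: "real^'n^'n" where S: "S ** transpose S = \<Omega>"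
    using pos_semidef_factorization[OF pos_def_imp_pos_semidef[OF \<Omega>]] by blast
  obtain D :: "real^'n^'n" where D: "D ** transpose D = cfusn_Delta \<Omega> \<Lambda>" and
    cdf: "\<And>y. normal_cdf (cfusn_Delta \<Omega> \<Lambda>) y = (\<integral>z. indicator {z. \<forall>i. (D *v z) $ i \<le> y $ i} z \<partial>?\<gamma>)"
    using normal_cdf_eq_integral[OF cfusn_Delta_pos_semidef[OF assms]] by blast
  \<comment> \<open>Write Y as \<open>S *v u\<close> with \<open>u\<close> standard normal. Then
    \<open>L\<close> applied to Y is \<open>P *v u\<close>, the variable t'Y is
    \<open>a \<bullet> u\<close>, and \<open>s\<close> will be its covariance vector with W.\<close>
  define L where "L = transpose \<Lambda> ** ?V"
  define P where "P = L ** S"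
  define a where "a = transpose S *v t"
  define s where "s = transpose \<Lambda> *v t"
  have sets_\<gamma>2: "sets (borel \<Otimes>\<^sub>M ?\<gamma>) = sets (borel :: ((real^'n) \<times> (real^'n)) measure)"
    by (subst borel_prod[symmetric]) (rule sets_pair_measure_cong, simp_all)
  \<comment> \<open>Such sets are closed, hence Borel. \<open>Q = mat 1\<close> gives the
    measurability of the cdf, \<open>Q = P\<close> that of the joint integrand for Fubini.\<close>
  have orthant_sets: "{w. \<forall>i. (D *v snd w) $ i \<le> (Q *v fst w) $ i} \<in> sets (borel \<Otimes>\<^sub>M ?\<gamma>)" for Q :: "real^'n^'n"
    unfolding sets_\<gamma>2
    by (intro borel_closed closed_Collect_all closed_Collect_le continuous_on_component
      continuous_on_compose2[OF matrix_vector_mult_linear_continuous_on[of UNIV]]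
      continuous_on_fst continuous_on_snd continuous_on_id) auto
  have [measurable]: "normal_cdf (cfusn_Delta \<Omega> \<Lambda>) \<in> borel_measurable borel"
  proof -
    have [measurable]: "{w. \<forall>i. (D *v snd w) $ i \<le> fst w $ i} \<in> sets (borel \<Otimes>\<^sub>M ?\<gamma>)"
      using orthant_sets[of "mat 1"] by simp
    have "normal_cdf (cfusn_Delta \<Omega> \<Lambda>) =
        (\<lambda>y. \<integral>z. indicator {w. \<forall>i. (D *v snd w) $ i \<le> fst w $ i} (y, z) \<partial>?\<gamma>)"
      unfolding cdf[abs_def]
      by (intro ext Bochner_Integration.integral_cong refl) (simp add: indicator_def)
    also have "\<dots> \<in> borel_measurable borel" by measurable
    finally show ?thesis .
  qed
  have [measurable]: "normal_pdf \<Omega> \<in> borel_measurable borel"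
    unfolding normal_pdf_def[abs_def] by measurable
  have pdf_nonneg: "0 \<le> normal_pdf \<Omega> x" for x
    by (simp add: normal_pdf_def S[symmetric] det_mul)
  have cdf_nonneg: "0 \<le> normal_cdf (cfusn_Delta \<Omega> \<Lambda>) y" for y
    by (simp add: normal_cdf_def)
  have aSu: "t \<bullet> (S *v u) = a \<bullet> u" for u
    by (simp add: a_def dot_lmul_matrix)

  \<comment> \<open>The standard deviation of the residual of t'Y after subtracting s'W; the
    radicand is nonnegative by admissibility.\<close>
  define c where "c = sqrt (t \<bullet> ((\<Omega> - \<Lambda> ** transpose \<Lambda>) *v t))"
  have c2: "s \<bullet> s + c\<^sup>2 = t \<bullet> (\<Omega> *v t)"
  proof -
    have "c\<^sup>2 = t \<bullet> ((\<Omega> - \<Lambda> ** transpose \<Lambda>) *v t)"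
      using \<Gamma> by (simp add: c_def pos_semidef_def)
    also have "\<dots> = t \<bullet> (\<Omega> *v t) - t \<bullet> (\<Lambda> *v s)"
      by (simp only: s_def matrix_vector_mult_diff_rdistrib inner_diff_right matrix_vector_mul_assoc)
    also have "t \<bullet> (\<Lambda> *v s) = s \<bullet> s"
      by (simp add: s_def dot_lmul_matrix)
    finally show ?thesis by simp
  qed
  have s_nth: "s $ i = column i \<Lambda> \<bullet> t" for i
    by (simp add: s_def matrix_vector_mul_component transpose_def column_def
      del: transpose_matrix_vector)
  have aa: "a \<bullet> a = t \<bullet> (\<Omega> *v t)"
    using aSu[of a] by (simp add: a_def S[symmetric] matrix_vector_mul_assoc[symmetric] del: transpose_matrix_vector)
  \<comment> \<open>The covariance vector of W with t'Y.\<close>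
  have Pa: "P *v a = s"
  proof -
    have "P *v a = (transpose \<Lambda> ** (?V ** (S ** transpose S))) *v t"
      by (simp only: P_def L_def a_def matrix_vector_mul_assoc matrix_mul_assoc)
    then show ?thesis by (simp add: S inv s_def del: transpose_matrix_vector)
  qed
  \<comment> \<open>The covariance matrix of W = \<open>P *v u - D *v z\<close>:
    \<open>P ** transpose P\<close> is exactly the matrix that \<open>cfusn_Delta\<close> subtracts
    from the identity.\<close>
  have PD: "P ** transpose P + D ** transpose D = mat 1"
  proof -
    have "P ** transpose P = transpose \<Lambda> ** (?V ** (S ** transpose S)) ** ?V ** \<Lambda>"
      by (simp add: P_def L_def matrix_transpose_mul symV matrix_mul_assoc)
    then show ?thesis by (simp add: S inv D cfusn_Delta_def)
  qed
  \<comment> \<open>In terms of \<open>(U, Z)\<close>, the functionals \<open>t'Y\<close> and \<open>W\<^sub>i\<close> are \<open>av\<close>; the model functionals \<open>bv\<close> have the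
    same Gram matrix, but depend on separate coordinates for \<open>W\<close> and for the residual of \<open>t'Y\<close>.\<close>
  define j0 :: 'n where "j0 = undefined"
  define W where "W i = vec_join (P $ i) (- (D $ i))" for i
  define av :: "'n option \<Rightarrow> real^('n + 'n)" where
    "av k = (case k of None \<Rightarrow> vec_join a 0 | Some i \<Rightarrow> W i)" for k
  define bv :: "'n option \<Rightarrow> real^('n + 'n)" where
    "bv k = (case k of None \<Rightarrow> vec_join s (axis j0 c) | Some i \<Rightarrow> axis (Inl i) 1)" for k
  have WW: "W i \<bullet> W j = (if i = j then 1 else 0)" for i j
  proof -
    have "W i \<bullet> W j = (P ** transpose P + D ** transpose D) $ i $ j"
      by (simp add: W_def inner_vec_join matrix_mult_transpose_dot_row row_def)
    then show ?thesis by (simp add: PD mat_def)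
  qed
  have aW: "vec_join a 0 \<bullet> W i = s $ i" for i
    by (simp add: W_def inner_vec_join Pa[symmetric] matrix_vector_mul_component inner_commute)
  have axis_nth: "axis k x $ l = (if l = k then x else 0)" for k l :: "'n + 'n" and x :: real
    by (simp add: axis_def)
  have Gram: "av k \<bullet> av l = bv k \<bullet> bv l" for k l
    using WW aW aa c2
    by (cases k; cases l)
      (auto simp: av_def bv_def inner_vec_join inner_axis inner_axis' inner_commute[of "W _" "vec_join a 0"]
        power2_eq_square axis_nth)
  \<comment> \<open>The index \<open>None\<close> carries the functional in the exponent, the
    indices \<open>Some i\<close> carry the orthant constraints.\<close>
  define G :: "('n option \<Rightarrow> real) \<Rightarrow> complex" where
    "G h = indicator {h. \<forall>i. 0 \<le> h (Some i)} h * iexp (h None)" for h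
  have [measurable]: "(\<lambda>v. G (\<lambda>k. f k \<bullet> v)) \<in> borel_measurable borel" for f :: "'n option \<Rightarrow> real^('n + 'n)"
  proof -
    have "(\<lambda>v. G (\<lambda>k. f k \<bullet> v)) = (\<lambda>v. indicator {v. \<forall>i. 0 \<le> f (Some i) \<bullet> v} v * iexp (f None \<bullet> v))"
      by (auto simp: G_def indicator_def)
    also have "\<dots> \<in> borel_measurable borel" by measurable
    finally show ?thesis .
  qed

  \<comment> \<open>After shifting the variable by \<open>\<mu>\<close>, the factor
    \<open>?C\<close> leaves the integral and \<open>?H\<close> is integrated against the law of
    Y.\<close>
  let ?H = "\<lambda>y. complex_of_real (normal_cdf (cfusn_Delta \<Omega> \<Lambda>) (L *v y)) * iexp (t \<bullet> y)"
  let ?C = "2 ^ CARD('n) * iexp (t \<bullet> \<mu>)"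
  have "char_vec (CFUSN \<mu> \<Omega> \<Lambda>) t = (CLINT x|lborel. cfusn_pdf \<mu> \<Omega> \<Lambda> x *\<^sub>R iexp (t \<bullet> x))"
    unfolding char_vec_def CFUSN_def
    by (rule integral_density) (auto simp: cfusn_pdf_def[abs_def] pdf_nonneg cdf_nonneg)
  also have "\<dots> = (CLINT x|distr lborel borel ((+) \<mu>). cfusn_pdf \<mu> \<Omega> \<Lambda> x *\<^sub>R iexp (t \<bullet> x))"
    by (simp add: lborel_distr_plus)
  also have "\<dots> = (CLINT y|lborel. cfusn_pdf \<mu> \<Omega> \<Lambda> (\<mu> + y) *\<^sub>R iexp (t \<bullet> (\<mu> + y)))"
    by (rule integral_distr) (auto simp: cfusn_pdf_def[abs_def])
  also have "\<dots> = (CLINT y|lborel. ?C * (normal_pdf \<Omega> y *\<^sub>R ?H y))"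
    by (simp add: cfusn_pdf_def L_def scaleR_conv_of_real inner_add_right distrib_left exp_add mult_ac)
  also have "\<dots> = ?C * (CLINT y|lborel. normal_pdf \<Omega> y *\<^sub>R ?H y)"
    by (rule integral_mult_right_zero)
  also have "(CLINT y|lborel. normal_pdf \<Omega> y *\<^sub>R ?H y) = (CLINT y|density lborel (\<lambda>x. ennreal (normal_pdf \<Omega> x)). ?H y)"
    by (rule integral_density[symmetric]) (auto simp: pdf_nonneg)
  also have "\<dots> = (CLINT u|?\<gamma>. ?H (S *v u))"
    unfolding density_normal_pdf[OF \<Omega> S] by (rule integral_distr) measurable
  \<comment> \<open>The cdf is itself an integral over an independent vector \<open>z\<close>, and
    \<open>L *v (S *v u) = P *v u\<close>.\<close>
  also have "\<dots> = (CLINT u|?\<gamma>. CLINT z|?\<gamma>. indicator {w. \<forall>i. (D *v snd w) $ i \<le> (P *v fst w) $ i} (u, z) * iexp (a \<bullet> u))"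
  proof (rule Bochner_Integration.integral_cong[OF refl])
    fix u
    have "?H (S *v u) = (CLINT z|?\<gamma>. complex_of_real (indicator {z. \<forall>i. (D *v z) $ i \<le> (P *v u) $ i} z)) * iexp (a \<bullet> u)"
      by (simp only: cdf integral_complex_of_real aSu matrix_vector_mul_assoc P_def)
    also have "\<dots> = (CLINT z|?\<gamma>. complex_of_real (indicator {z. \<forall>i. (D *v z) $ i \<le> (P *v u) $ i} z) * iexp (a \<bullet> u))"
      by (rule integral_mult_left_zero[symmetric])
    also have "\<dots> = (CLINT z|?\<gamma>. indicator {w. \<forall>i. (D *v snd w) $ i \<le> (P *v fst w) $ i} (u, z) * iexp (a \<bullet> u))"
      by (intro Bochner_Integration.integral_cong refl) (auto split: split_indicator)
    finally show "?H (S *v u) = \<dots>" .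
  qed
  also have "\<dots> = (CLINT w|?\<gamma> \<Otimes>\<^sub>M ?\<gamma>. indicator {w. \<forall>i. (D *v snd w) $ i \<le> (P *v fst w) $ i} w * iexp (a \<bullet> fst w))"
  proof -
    have "sets (?\<gamma> \<Otimes>\<^sub>M ?\<gamma>) = sets (borel \<Otimes>\<^sub>M ?\<gamma>)"
      by (rule sets_pair_measure_cong) simp_all
    then have [measurable]: "{w. \<forall>i. (D *v snd w) $ i \<le> (P *v fst w) $ i} \<in> sets (?\<gamma> \<Otimes>\<^sub>M ?\<gamma>)"
      using orthant_sets by simp
    have "integrable (?\<gamma> \<Otimes>\<^sub>M ?\<gamma>) (\<lambda>w. indicator {w. \<forall>i. (D *v snd w) $ i \<le> (P *v fst w) $ i} w * iexp (a \<bullet> fst w))"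
      by (rule \<gamma>2.P.integrable_const_bound[where B=1]) (auto simp: norm_mult split: split_indicator)
    from \<gamma>2.integral_fst'[OF this] show ?thesis by simp
  qed
  \<comment> \<open>The coordinatewise bound of \<open>D *v z\<close> by \<open>P *v u\<close> says
    that each \<open>W i \<bullet> vec_join u z\<close> is nonnegative.\<close>
  also have "\<dots> = (CLINT w|?\<gamma> \<Otimes>\<^sub>M ?\<gamma>. G (\<lambda>k. av k \<bullet> (\<lambda>(u, z). vec_join u z) w))"
  proof (intro Bochner_Integration.integral_cong refl)
    fix w :: "(real^'n) \<times> (real^'n)"
    obtain u z where w: "w = (u, z)" by fastforce
    have "W i \<bullet> vec_join u z = (P *v u) $ i - (D *v z) $ i" for i
      by (simp add: W_def inner_vec_join matrix_vector_mul_component)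
    then show "indicator {w. \<forall>i. (D *v snd w) $ i \<le> (P *v fst w) $ i} w * iexp (a \<bullet> fst w) =
        G (\<lambda>k. av k \<bullet> (\<lambda>(u, z). vec_join u z) w)"
      by (simp add: w G_def av_def inner_vec_join indicator_def)
  qed
  also have "\<dots> = (CLINT v|distr (?\<gamma> \<Otimes>\<^sub>M ?\<gamma>) borel (\<lambda>(u, z). vec_join u z). G (\<lambda>k. av k \<bullet> v))"
    by (rule integral_distr[symmetric]) measurable
  also have "\<dots> = (CLINT v|std_normal_vec. G (\<lambda>k. av k \<bullet> v))"
    unfolding distr_std_normal_vec_join ..
  also have "\<dots> = (CLINT v|std_normal_vec. G (\<lambda>k. bv k \<bullet> v))"
    by (rule integral_std_normal_vec_equal_Gram[OF Gram]) measurable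
  also have "\<dots> = (CLINT v|(std_normal_vec :: (real^('n + 'n)) measure).
      indicator {v. \<forall>i. 0 \<le> v $ Inl i} v * iexp (vec_join s (axis j0 c) \<bullet> v))"
    by (simp add: G_def bv_def inner_axis' indicator_def)
  also have "\<dots> = complex_of_real (exp (- (t \<bullet> (\<Omega> *v t)) / 2)) * (\<Prod>i\<in>UNIV. (1 + \<i> * Im_fun (s $ i)) / 2)"
    unfolding integral_std_normal_vec_half_char c2 by simp
  \<comment> \<open>The power of 2 in \<open>?C\<close> cancels the halves in the product.\<close>
  also have "?C * \<dots> = iexp (t \<bullet> \<mu>) * complex_of_real (exp (- (t \<bullet> (\<Omega> *v t)) / 2)) *
      (\<Prod>i\<in>UNIV. 1 + \<i> * Im_fun (s $ i))"
    by (simp add: prod_dividef)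
  also have "iexp (t \<bullet> \<mu>) * complex_of_real (exp (- (t \<bullet> (\<Omega> *v t)) / 2)) =
      exp (\<i> * complex_of_real (t \<bullet> \<mu>) - complex_of_real (t \<bullet> (\<Omega> *v t)) / 2)"
  proof -
    have "\<i> * complex_of_real (t \<bullet> \<mu>) - complex_of_real (t \<bullet> (\<Omega> *v t)) / 2 =
        \<i> * complex_of_real (t \<bullet> \<mu>) + complex_of_real (- (t \<bullet> (\<Omega> *v t)) / 2)" by simp
    then show ?thesis by (simp only: exp_add exp_of_real)
  qed
  finally show "char_vec (CFUSN \<mu> \<Omega> \<Lambda>) t =
      exp (\<i> * complex_of_real (t \<bullet> \<mu>) - complex_of_real (t \<bullet> (\<Omega> *v t)) / 2) *
      (\<Prod>i\<in>UNIV. (1 + \<i> * complex_of_real (Im_fun (column i \<Lambda> \<bullet> t))))"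
    by (simp only: s_nth)
qed

end
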